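(* Let $A$ be a $K$-Banach algebra, let $0<s\le r$ be real numbers and let $\delta\colon A\to A$ be a bounded $K$-linear derivation with spectral radius $|\delta|_{\mathrm{sp},A}<s$. Then $A\langle \partial/r,s/\partial\rangle$, equipped with the star product $\ast$, is an associative (unital) $K$-Banach algebra.
   Context: $K$ is a field complete for a non-archimedean absolute value with $|p|=1/p$. A $K$-Banach algebra is a $K$-Banach space $A$ with an associative unital multiplication that is bounded: $|ab|\le C|a||b|$ for some constant $C$. For a bounded operator $T$ on a Banach space $V$, $|T|_{\mathrm{sp},V}=\lim_{k\to\infty}\|T^k\|^{1/k}$ (operator norm). For a $K$-Banach space $A$ and a formal variable $\partial$, $A\langle\partial/r,s/\partial\rangle$ is the set of formal sums $\sum_{j\in\mathbb{Z}}a_j\partial^j$ with $a_j\in A$ such that $|a_j|t^j\to0$ as $|j|\to\infty$ for every $t\in[s,r]$, normed by $|\sum a_j\partial^j|=\sup_{s\le t\le r}\sup_j |a_j|t^j$. For $u=\sum u_i\partial^i$, $v=\sum v_j\partial^j$ in this space, the star product is $u\ast v=\sum_{k\in\mathbb{Z}}(u\ast_k v)\partial^k$ where \[u\ast_k v=\sum_{i\in\mathbb{Z}}u_i\sum_{m\ge0}\binom{i}{m}\delta^m(v_{k-i+m}),\] with $\binom{i}{m}=i(i-1)\cdots(i-m+1)/m!$ for $i\in\mathbb{Z}$; under the hypothesis $|\delta|_{\mathrm{sp},A}<s$ these series converge and $u\ast v$ lies in $A\langle\partial/r,s/\partial\rangle$. *)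

theory Defs
  imports "HOL-Analysis.Analysis" "HOL-Algebra.Module" "HOL-Computational_Algebra.Primes"
begin

section \<open>Normed additive groups as metric spaces\<close>

text \<open>Outside the carrier the distance is set to 0, because the locale \<^locale>\<open>Metric_space\<close> asks for
  nonnegativity and symmetry on the whole type.\<close>

definition norm_dist :: "('a, 'm) ring_scheme \<Rightarrow> ('a \<Rightarrow> real) \<Rightarrow> 'a \<Rightarrow> 'a \<Rightarrow> real" where
  "norm_dist G nrm x y =
     (if x \<in> carrier G \<and> y \<in> carrier G then nrm (x \<ominus>\<^bsub>G\<^esub> y) else 0)"

definition norm_complete :: "('a, 'm) ring_scheme \<Rightarrow> ('a \<Rightarrow> real) \<Rightarrow> bool" where
  "norm_complete G nrm \<longleftrightarrow> Metric_space.mcomplete (carrier G) (norm_dist G nrm)"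

definition norm_topology :: "('a, 'm) ring_scheme \<Rightarrow> ('a \<Rightarrow> real) \<Rightarrow> 'a topology" where
  "norm_topology G nrm = Metric_space.mtopology (carrier G) (norm_dist G nrm)"

text \<open>Infinite sums are unconditional: limits of the net of finite partial sums, as in
  \<^const>\<open>has_sum\<close>.\<close>

definition has_norm_sum ::
  "('a, 'm) ring_scheme \<Rightarrow> ('a \<Rightarrow> real) \<Rightarrow> ('i \<Rightarrow> 'a) \<Rightarrow> 'i set \<Rightarrow> 'a \<Rightarrow> bool" where
  "has_norm_sum G nrm f I x \<longleftrightarrow>
     limitin (norm_topology G nrm) (finsum G f) x (finite_subsets_at_top I)"

definition norm_summable ::
  "('a, 'm) ring_scheme \<Rightarrow> ('a \<Rightarrow> real) \<Rightarrow> ('i \<Rightarrow> 'a) \<Rightarrow> 'i set \<Rightarrow> bool" where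
  "norm_summable G nrm f I \<longleftrightarrow> (\<exists>x. has_norm_sum G nrm f I x)"

definition norm_sum ::
  "('a, 'm) ring_scheme \<Rightarrow> ('a \<Rightarrow> real) \<Rightarrow> ('i \<Rightarrow> 'a) \<Rightarrow> 'i set \<Rightarrow> 'a" where
  "norm_sum G nrm f I = (THE x. has_norm_sum G nrm f I x)"


section \<open>Non-archimedean fields, Banach spaces and Banach algebras\<close>

locale complete_valued_field = field K for K (structure) +
  fixes absv :: "'k \<Rightarrow> real"
  assumes absv_nonneg: "x \<in> carrier K \<Longrightarrow> 0 \<le> absv x"
    and absv_eq_0_iff: "x \<in> carrier K \<Longrightarrow> absv x = 0 \<longleftrightarrow> x = \<zero>"
    and absv_mult: "\<lbrakk>x \<in> carrier K; y \<in> carrier K\<rbrakk> \<Longrightarrow> absv (x \<otimes> y) = absv x * absv y"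
    and absv_add: "\<lbrakk>x \<in> carrier K; y \<in> carrier K\<rbrakk> \<Longrightarrow> absv (x \<oplus> y) \<le> max (absv x) (absv y)"
    and absv_complete: "norm_complete K absv"

locale nonarch_banach_space =
  complete_valued_field K absv + Module.module K V
  for K (structure) and absv :: "'k \<Rightarrow> real" and V (structure) +
  fixes nrm :: "'a \<Rightarrow> real"
  assumes nrm_nonneg: "x \<in> carrier V \<Longrightarrow> 0 \<le> nrm x"
    and nrm_eq_0_iff: "x \<in> carrier V \<Longrightarrow> nrm x = 0 \<longleftrightarrow> x = \<zero>\<^bsub>V\<^esub>"
    and nrm_add: "\<lbrakk>x \<in> carrier V; y \<in> carrier V\<rbrakk> \<Longrightarrow> nrm (x \<oplus>\<^bsub>V\<^esub> y) \<le> max (nrm x) (nrm y)"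
    and nrm_smult: "\<lbrakk>c \<in> carrier K; x \<in> carrier V\<rbrakk> \<Longrightarrow> nrm (c \<odot>\<^bsub>V\<^esub> x) = absv c * nrm x"
    and nrm_complete: "norm_complete V nrm"

text \<open>The locale \<^locale>\<open>Module.algebra\<close> is not used since it requires commutativity.\<close>

locale nonarch_banach_algebra =
  nonarch_banach_space K absv A nrm + ring A
  for K (structure) and absv :: "'k \<Rightarrow> real" and A (structure) and nrm :: "'a \<Rightarrow> real" +
  assumes smult_mult_left: "\<lbrakk>c \<in> carrier K; x \<in> carrier A; y \<in> carrier A\<rbrakk>
      \<Longrightarrow> (c \<odot>\<^bsub>A\<^esub> x) \<otimes>\<^bsub>A\<^esub> y = c \<odot>\<^bsub>A\<^esub> (x \<otimes>\<^bsub>A\<^esub> y)"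
    and smult_mult_right: "\<lbrakk>c \<in> carrier K; x \<in> carrier A; y \<in> carrier A\<rbrakk>
      \<Longrightarrow> x \<otimes>\<^bsub>A\<^esub> (c \<odot>\<^bsub>A\<^esub> y) = c \<odot>\<^bsub>A\<^esub> (x \<otimes>\<^bsub>A\<^esub> y)"
    and mult_bounded:
      "\<exists>C. \<forall>x\<in>carrier A. \<forall>y\<in>carrier A. nrm (x \<otimes>\<^bsub>A\<^esub> y) \<le> C * nrm x * nrm y"


section \<open>Operators\<close>

definition linear_operator ::
  "('k, 'mk) ring_scheme \<Rightarrow> ('k, 'a, 'm) module_scheme \<Rightarrow> ('a \<Rightarrow> 'a) \<Rightarrow> bool" where
  "linear_operator K V T \<longleftrightarrow>
     T \<in> carrier V \<rightarrow> carrier V \<and>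
     (\<forall>x\<in>carrier V. \<forall>y\<in>carrier V. T (x \<oplus>\<^bsub>V\<^esub> y) = T x \<oplus>\<^bsub>V\<^esub> T y) \<and>
     (\<forall>c\<in>carrier K. \<forall>x\<in>carrier V. T (c \<odot>\<^bsub>V\<^esub> x) = c \<odot>\<^bsub>V\<^esub> T x)"

definition bounded_operator :: "('a, 'm) ring_scheme \<Rightarrow> ('a \<Rightarrow> real) \<Rightarrow> ('a \<Rightarrow> 'a) \<Rightarrow> bool" where
  "bounded_operator V nrm T \<longleftrightarrow> (\<exists>C. \<forall>x\<in>carrier V. nrm (T x) \<le> C * nrm x)"

definition derivation :: "('a, 'm) ring_scheme \<Rightarrow> ('a \<Rightarrow> 'a) \<Rightarrow> bool" where
  "derivation R d \<longleftrightarrow>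
     (\<forall>x\<in>carrier R. \<forall>y\<in>carrier R.
        d (x \<oplus>\<^bsub>R\<^esub> y) = d x \<oplus>\<^bsub>R\<^esub> d y \<and>
        d (x \<otimes>\<^bsub>R\<^esub> y) = d x \<otimes>\<^bsub>R\<^esub> y \<oplus>\<^bsub>R\<^esub> x \<otimes>\<^bsub>R\<^esub> d y)"

text \<open>As in \<^const>\<open>onorm\<close>, the vector 0 contributes the harmless quotient 0/0 = 0.\<close>

definition op_norm :: "('a, 'm) ring_scheme \<Rightarrow> ('a \<Rightarrow> real) \<Rightarrow> ('a \<Rightarrow> 'a) \<Rightarrow> real" where
  "op_norm V nrm T = (SUP x\<in>carrier V. nrm (T x) / nrm x)"

definition spectral_radius :: "('a, 'm) ring_scheme \<Rightarrow> ('a \<Rightarrow> real) \<Rightarrow> ('a \<Rightarrow> 'a) \<Rightarrow> real" where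
  "spectral_radius V nrm T = lim (\<lambda>k. root k (op_norm V nrm (T ^^ k)))"


section \<open>The twisted Laurent series algebra on the annulus \<open>s \<le> |\<partial>| \<le> r\<close>\<close>

text \<open>The formal sum of the \<open>a\<^sub>j \<partial>\<^sup>j\<close> is represented by the function \<open>j \<mapsto> a\<^sub>j\<close>.\<close>

definition annulus_carrier ::
  "('a, 'm) ring_scheme \<Rightarrow> ('a \<Rightarrow> real) \<Rightarrow> real \<Rightarrow> real \<Rightarrow> (int \<Rightarrow> 'a) set" where
  "annulus_carrier A nrm s r =
     {u. (\<forall>j. u j \<in> carrier A) \<and>
         (\<forall>t\<in>{s..r}. ((\<lambda>j. nrm (u j) * t powi j) \<longlongrightarrow> 0) (filtercomap abs at_top))}"

definition annulus_norm :: "('a \<Rightarrow> real) \<Rightarrow> real \<Rightarrow> real \<Rightarrow> (int \<Rightarrow> 'a) \<Rightarrow> real" where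
  "annulus_norm nrm s r u = (SUP t\<in>{s..r}. SUP j. nrm (u j) * t powi j)"

text \<open>The generalized binomial coefficient of an integer, as an integer (the division is exact, also for
  negative \<open>i\<close>); it acts on \<open>A\<close> by integer multiples. The library's \<open>gchoose\<close> is restricted to fields of
  characteristic 0 by its type constraint.\<close>

definition int_binom :: "int \<Rightarrow> nat \<Rightarrow> int" where
  "int_binom i m = (\<Prod>l<m. i - int l) div fact m"

definition star_inner ::
  "('a, 'm) ring_scheme \<Rightarrow> ('a \<Rightarrow> 'a) \<Rightarrow> (int \<Rightarrow> 'a) \<Rightarrow> int \<Rightarrow> int \<Rightarrow> nat \<Rightarrow> 'a" where
  "star_inner A \<delta> v k i m = [int_binom i m] \<cdot>\<^bsub>A\<^esub> ((\<delta> ^^ m) (v (k - i + int m)))"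

definition star_outer ::
  "('a, 'm) ring_scheme \<Rightarrow> ('a \<Rightarrow> real) \<Rightarrow> ('a \<Rightarrow> 'a) \<Rightarrow> (int \<Rightarrow> 'a) \<Rightarrow> (int \<Rightarrow> 'a) \<Rightarrow> int \<Rightarrow> int \<Rightarrow> 'a"
  where
  "star_outer A nrm \<delta> u v k i = u i \<otimes>\<^bsub>A\<^esub> norm_sum A nrm (star_inner A \<delta> v k i) UNIV"

definition star_product ::
  "('a, 'm) ring_scheme \<Rightarrow> ('a \<Rightarrow> real) \<Rightarrow> ('a \<Rightarrow> 'a) \<Rightarrow> (int \<Rightarrow> 'a) \<Rightarrow> (int \<Rightarrow> 'a) \<Rightarrow> int \<Rightarrow> 'a" where
  "star_product A nrm \<delta> u v k = norm_sum A nrm (star_outer A nrm \<delta> u v k) UNIV"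

text \<open>All series defining the star product of \<open>u\<close> and \<open>v\<close> converge, so that the values of
  \<^const>\<open>norm_sum\<close> above are actual sums.\<close>

definition star_convergent ::
  "('a, 'm) ring_scheme \<Rightarrow> ('a \<Rightarrow> real) \<Rightarrow> ('a \<Rightarrow> 'a) \<Rightarrow> (int \<Rightarrow> 'a) \<Rightarrow> (int \<Rightarrow> 'a) \<Rightarrow> bool" where
  "star_convergent A nrm \<delta> u v \<longleftrightarrow>
     (\<forall>k. (\<forall>i. norm_summable A nrm (star_inner A \<delta> v k i) UNIV) \<and>
          norm_summable A nrm (star_outer A nrm \<delta> u v k) UNIV)"

definition annulus_algebra ::
  "('k, 'a, 'm) module_scheme \<Rightarrow> ('a \<Rightarrow> real) \<Rightarrow> ('a \<Rightarrow> 'a) \<Rightarrow> real \<Rightarrow> real \<Rightarrow> ('k, int \<Rightarrow> 'a) module"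
  where
  "annulus_algebra A nrm \<delta> s r =
     \<lparr>carrier = annulus_carrier A nrm s r,
      mult = star_product A nrm \<delta>,
      one = (\<lambda>j. if j = 0 then \<one>\<^bsub>A\<^esub> else \<zero>\<^bsub>A\<^esub>),
      zero = (\<lambda>j. \<zero>\<^bsub>A\<^esub>),
      add = (\<lambda>u v j. u j \<oplus>\<^bsub>A\<^esub> v j),
      smult = (\<lambda>c u j. c \<odot>\<^bsub>A\<^esub> u j)\<rparr>"

end

theory Submission
  imports Defs
begin

text \<open>
  Write \<open>u * v = (\<Sum>i. u\<^sub>i T\<^sup>i v)\<close>, where \<open>T v = \<partial> * v\<close> has the coefficients
  \<open>v\<^sub>k\<^sub>-\<^sub>1 + \<delta>(v\<^sub>k)\<close>, that is, \<open>T\<close> is the translation of the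
  coefficients plus \<open>\<delta>\<close>. As these two operators commute and \<open>\<delta>\<close> has spectral radius less
  than \<open>s\<close>, \<open>T\<close> is invertible, and the binomial series gives all its integer powers;
  Pascal's rule shows that they do form a group. The Leibniz rule for \<open>\<delta>\<close> yields
  \<open>T(v * w) = (T v) * w\<close>, hence \<open>T\<^sup>i(v * w) = (T\<^sup>i v) * w\<close> for all integers \<open>i\<close>,
  and associativity follows by exchanging two sums. Neither Vandermonde's identity nor the higher
  Leibniz rule is needed. All estimates rest on the fact that the norm of a convergent
  non-archimedean sum is at most the norm of one of its terms.
\<close>

section \<open>Functions vanishing at infinity\<close>

text \<open>The index of a coefficient of the star product couples three indices,
  \<open>k = i + l - m\<close>, and the estimates have to decouple them. At a fixed radius
  \<open>t\<close> the weight \<open>t powi k\<close> splits accordingly, and the size of a term is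
  bounded, up to the constant \<open>C * M\<close>, by a product of three independent null families:
  \<open>nrm (u i) * t powi i\<close>, \<open>(\<rho> / t) ^ m\<close> and
  \<open>nrm (v l) * t powi l\<close>. The middle one is null because \<rho> < s \<le> t; the
  binomial coefficients contribute nothing, since integer multiples do not increase a
  non-archimedean norm. A product of null families is null on the product index set, and nullity
  survives pushing a bound forward along the index map. Hence one triple family controls both the
  decay of the coefficients of \<open>u \<star> v\<close> and the exchange of sums. The numbers
  \<open>M\<close> and \<rho> come from the spectral radius:
  \<open>nrm ((\<delta> ^^ m) x) \<le> M * \<rho> ^ m * nrm x\<close> with \<rho> still below
  \<open>s\<close>. Finite superlevel sets, in place of a filter on the integers, let one notion of
  null family serve integers, naturals and tuples.\<close>

definition vanishing :: "('i \<Rightarrow> real) \<Rightarrow> bool" where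
  "vanishing g \<longleftrightarrow> (\<forall>e>0. finite {i. e \<le> g i})"

lemma vanishingD: "vanishing g \<Longrightarrow> 0 < e \<Longrightarrow> finite {i. e \<le> g i}"
  by (simp add: vanishing_def)

text \<open>A superlevel set of \<open>g\<close> lies in the image under \<pi> of a superlevel set
  of \<open>h\<close>, and images of finite sets are finite even if \<pi> has infinite fibres. A
  single dominating \<open>p\<close> over each \<open>k\<close> suffices, which is what the estimate
  of a sum by one of its terms delivers.\<close>

lemma vanishing_dominated:
  assumes "vanishing h" and le: "\<And>k. \<exists>p. \<pi> p = k \<and> g k \<le> C * h p" and "0 \<le> C"
  shows "vanishing g"
  unfolding vanishing_def
proof (intro allI impI)
  fix e :: real assume e: "0 < e"
  \<comment> \<open>\<open>C + 1\<close> instead of \<open>C\<close> keeps the divisor positive when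
    \<open>C = 0\<close>.\<close>
  have "{k. e \<le> g k} \<subseteq> \<pi> ` {p. e / (C + 1) \<le> h p}"
  proof
    fix k assume k: "k \<in> {k. e \<le> g k}"
    obtain p where p: "\<pi> p = k" "g k \<le> C * h p"
      using le by blast
    have Ch: "0 < C * h p"
      using k p(2) e by simp
    then have "0 < h p"
      using \<open>0 \<le> C\<close> by (auto simp: zero_less_mult_iff)
    then have "e \<le> h p * (C + 1)"
      using k p(2) by (simp add: algebra_simps)
    then have "e / (C + 1) \<le> h p"
      using \<open>0 \<le> C\<close> by (simp add: divide_le_eq)
    with p(1) show "k \<in> \<pi> ` {p. e / (C + 1) \<le> h p}"
      by blast
  qed
  moreover have "finite {p. e / (C + 1) \<le> h p}"
    using assms(1) e \<open>0 \<le> C\<close> by (intro vanishingD) auto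
  ultimately show "finite {k. e \<le> g k}"
    using finite_surj by blast
qed

lemma vanishing_le:
  assumes "vanishing h" and "\<And>i. g i \<le> C * h i" and "0 \<le> C"
  shows "vanishing g"
  using vanishing_dominated[of h id g C] assms by simp

lemma vanishing_compose_inj:
  assumes "vanishing h" and "inj \<pi>"
  shows "vanishing (\<lambda>i. h (\<pi> i))"
  unfolding vanishing_def
proof (intro allI impI)
  fix e :: real assume e: "0 < e"
  have "finite (\<pi> -` {p. e \<le> h p})"
    by (rule finite_vimageI) (use assms e vanishingD in auto)
  then show "finite {i. e \<le> h (\<pi> i)}"
    by (simp add: vimage_def)
qed

lemma vanishing_bounded:
  assumes "vanishing g"
  obtains B where "0 < B" "\<And>i. g i \<le> B"
proof
  let ?F = "{i. 1 \<le> g i}"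
  \<comment> \<open>The inserted 1 makes the maximum exist and be positive even if no value reaches
    1.\<close>
  let ?B = "Max (insert 1 (g ` ?F))"
  have fin: "finite (insert 1 (g ` ?F))"
    using vanishingD[OF assms, of 1] by simp
  show "0 < ?B"
    using Max_ge[OF fin, of 1] by simp
  show "g i \<le> ?B" for i
  proof (cases "1 \<le> g i")
    case True
    then show ?thesis
      using Max_ge[OF fin, of "g i"] by simp
  next
    case False
    then show ?thesis
      using Max_ge[OF fin, of 1] by simp
  qed
qed

text \<open>If a product is at least \<open>e\<close>, each factor is at least \<open>e\<close>
  divided by an upper bound of the other one, so the superlevel set sits in a finite
  rectangle.\<close>

lemma vanishing_prod:
  assumes a: "vanishing a" "\<And>i. 0 \<le> a i" and b: "vanishing b" "\<And>j. 0 \<le> b j"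
  shows "vanishing (\<lambda>(i, j). a i * b j)"
  unfolding vanishing_def
proof (intro allI impI)
  fix e :: real assume e: "0 < e"
  obtain Ba where Ba: "0 < Ba" "\<And>i. a i \<le> Ba"
    using vanishing_bounded[OF a(1)] by blast
  obtain Bb where Bb: "0 < Bb" "\<And>j. b j \<le> Bb"
    using vanishing_bounded[OF b(1)] by blast
  have "{p. e \<le> (case p of (i, j) \<Rightarrow> a i * b j)} \<subseteq> {i. e / Bb \<le> a i} \<times> {j. e / Ba \<le> b j}"
  proof clarify
    fix i j assume ij: "e \<le> a i * b j"
    have "a i * b j \<le> a i * Bb" "a i * b j \<le> Ba * b j"
      using Ba(2)[of i] Bb(2)[of j] a(2)[of i] b(2)[of j] by (auto intro: mult_left_mono mult_right_mono)
    with ij show "i \<in> {i. e / Bb \<le> a i} \<and> j \<in> {j. e / Ba \<le> b j}"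
      using Ba(1) Bb(1) by (simp add: divide_le_eq mult.commute)
  qed
  moreover have "finite ({i. e / Bb \<le> a i} \<times> {j. e / Ba \<le> b j})"
    using vanishingD[OF a(1), of "e / Bb"] vanishingD[OF b(1), of "e / Ba"] e Ba(1) Bb(1) by simp
  ultimately show "finite {p. e \<le> (case p of (i, j) \<Rightarrow> a i * b j)}"
    using finite_subset by blast
qed

lemma vanishing_power:
  fixes q :: real
  assumes "0 \<le> q" "q < 1"
  shows "vanishing (\<lambda>m::nat. q ^ m)"
  unfolding vanishing_def
proof (intro allI impI)
  fix e :: real assume e: "0 < e"
  have "(\<lambda>m. q ^ m) \<longlonglongrightarrow> 0"
    using assms by (intro LIMSEQ_power_zero) simp
  then have "eventually (\<lambda>m. q ^ m < e) sequentially"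
    using e by (rule order_tendstoD)
  then obtain N where N: "\<And>m. N \<le> m \<Longrightarrow> q ^ m < e"
    by (auto simp: eventually_sequentially)
  have "{m. e \<le> q ^ m} \<subseteq> {..N}"
  proof
    fix m assume "m \<in> {m. e \<le> q ^ m}"
    with N[of m] show "m \<in> {..N}"
      by (cases "N \<le> m") auto
  qed
  then show "finite {m. e \<le> q ^ m}"
    using finite_subset by blast
qed

text \<open>Bridge to the decay condition in \<open>annulus_carrier\<close>: a set of integers is
  finite exactly when it lies in some interval \<open>{-N..N}\<close>.\<close>

lemma vanishing_iff_tendsto_abs:
  fixes g :: "int \<Rightarrow> real"
  assumes "\<And>j. 0 \<le> g j"
  shows "(g \<longlongrightarrow> 0) (filtercomap abs at_top) \<longleftrightarrow> vanishing g"
proof -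
  have "(\<forall>\<^sub>F j in filtercomap abs at_top. dist (g j) 0 < e) \<longleftrightarrow> finite {i. e \<le> g i}"
    if "e > 0" for e
  proof
    assume "\<forall>\<^sub>F j in filtercomap abs at_top. dist (g j) 0 < e"
    then obtain N where N: "\<And>j. N \<le> \<bar>j\<bar> \<Longrightarrow> dist (g j) 0 < e"
      unfolding eventually_filtercomap_at_top_linorder by blast
    have "{i. e \<le> g i} \<subseteq> {-N..N}"
    proof
      fix i assume i: "i \<in> {i. e \<le> g i}"
      show "i \<in> {-N..N}"
      proof (rule ccontr)
        assume "i \<notin> {-N..N}"
        then have "N \<le> \<bar>i\<bar>" by auto
        from N[OF this] i assms[of i] show False by simp
      qed
    qed
    then show "finite {i. e \<le> g i}"
      using finite_subset by blast
  next
    assume fin: "finite {i. e \<le> g i}"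
    let ?N = "Max (insert 0 (abs ` {i. e \<le> g i})) + 1"
    have "dist (g j) 0 < e" if "?N \<le> \<bar>j\<bar>" for j
    proof (rule ccontr)
      assume "\<not> dist (g j) 0 < e"
      then have "j \<in> {i. e \<le> g i}"
        using assms[of j] by simp
      then have "\<bar>j\<bar> \<le> Max (insert 0 (abs ` {i. e \<le> g i}))"
        using fin by (intro Max_ge) auto
      with that show False by simp
    qed
    then show "\<forall>\<^sub>F j in filtercomap abs at_top. dist (g j) 0 < e"
      unfolding eventually_filtercomap_at_top_linorder by blast
  qed
  then show ?thesis
    unfolding tendsto_iff vanishing_def by blast
qed


section \<open>Summation in complete non-archimedean groups\<close>

text \<open>Scalars are left out so that the theory applies to the coefficients and also to the
  annulus algebra before that is known to be a Banach space. Without a scalar -1 the symmetry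
  \<open>nrm_uminus\<close> has to be an axiom.\<close>

locale nonarch_normed_group = abelian_group G for G (structure) +
  fixes nrm :: "'a \<Rightarrow> real"
  assumes nrm_nonneg: "x \<in> carrier G \<Longrightarrow> 0 \<le> nrm x"
    and nrm_eq_0_iff: "x \<in> carrier G \<Longrightarrow> nrm x = 0 \<longleftrightarrow> x = \<zero>"
    and nrm_add: "\<lbrakk>x \<in> carrier G; y \<in> carrier G\<rbrakk> \<Longrightarrow> nrm (x \<oplus> y) \<le> max (nrm x) (nrm y)"
    and nrm_uminus: "x \<in> carrier G \<Longrightarrow> nrm (\<ominus> x) = nrm x"
begin

lemma nrm_zero: "nrm \<zero> = 0"
  using nrm_eq_0_iff[of \<zero>] by simp

lemma nrm_minus_commute: "\<lbrakk>x \<in> carrier G; y \<in> carrier G\<rbrakk> \<Longrightarrow> nrm (x \<ominus> y) = nrm (y \<ominus> x)"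
  using nrm_uminus[of "x \<ominus> y"] by (simp add: minus_eq minus_add a_comm)

lemma nrm_triangle:
  assumes "x \<in> carrier G" "y \<in> carrier G" "z \<in> carrier G"
  shows "nrm (x \<ominus> z) \<le> max (nrm (x \<ominus> y)) (nrm (y \<ominus> z))"
proof -
  have "x \<ominus> z = (x \<ominus> y) \<oplus> (y \<ominus> z)"
    using assms by (simp add: minus_eq a_assoc) (metis a_assoc a_inv_closed l_neg l_zero)
  then show ?thesis
    using nrm_add[of "x \<ominus> y" "y \<ominus> z"] assms by simp
qed

text \<open>Repeated addition of one element stays within its norm by the ultrametric inequality.
  This removes the binomial coefficients from all estimates.\<close>

lemma nrm_int_mult_le:
  assumes "x \<in> carrier G"
  shows "nrm ([(n::int)] \<cdot>\<^bsub>G\<^esub> x) \<le> nrm x"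
proof -
  have nat: "nrm ([(m::nat)] \<cdot>\<^bsub>G\<^esub> x) \<le> nrm x" for m
  proof (induction m)
    case 0
    then show ?case using assms nrm_zero nrm_nonneg by simp
  next
    case (Suc m)
    then show ?case
      using nrm_add[of "[m] \<cdot>\<^bsub>G\<^esub> x" x] assms by simp
  qed
  show ?thesis
    by (cases "0 \<le> n") (use nat assms in \<open>auto simp: add_pow_int_ge add_pow_int_lt nrm_uminus\<close>)
qed

lemma nrm_minus_eq_0_iff: "\<lbrakk>x \<in> carrier G; y \<in> carrier G\<rbrakk> \<Longrightarrow> nrm (x \<ominus> y) = 0 \<longleftrightarrow> x = y"
  using nrm_eq_0_iff[of "x \<ominus> y"] by (metis minus_closed minus_eq minus_equality minus_minus r_neg a_inv_closed)

lemma Metric_space_norm_dist: "Metric_space (carrier G) (norm_dist G nrm)"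
proof
  fix x y z
  show "0 \<le> norm_dist G nrm x y"
    by (simp add: norm_dist_def nrm_nonneg)
  show "norm_dist G nrm x y = norm_dist G nrm y x"
    by (simp add: norm_dist_def nrm_minus_commute)
  show "x \<in> carrier G \<Longrightarrow> y \<in> carrier G \<Longrightarrow> norm_dist G nrm x y = 0 \<longleftrightarrow> x = y"
    by (simp add: norm_dist_def nrm_minus_eq_0_iff)
  assume xyz: "x \<in> carrier G" "y \<in> carrier G" "z \<in> carrier G"
  have "0 \<le> nrm (x \<ominus> y)" "0 \<le> nrm (y \<ominus> z)"
    using xyz by (simp_all add: nrm_nonneg)
  with nrm_triangle[OF xyz] xyz
  show "norm_dist G nrm x z \<le> norm_dist G nrm x y + norm_dist G nrm y z"
    by (simp add: norm_dist_def)
qed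

sublocale metric: Metric_space "carrier G" "norm_dist G nrm"
  by (rule Metric_space_norm_dist)

text \<open>For sequences inside the carrier the default value 0 of \<open>norm_dist\<close> never
  occurs, so completeness becomes a plain epsilon statement. It is used in one direction for the
  coefficients and in the other for the annulus algebra.\<close>

lemma norm_complete_iff:
  "norm_complete G nrm \<longleftrightarrow>
     (\<forall>\<sigma> :: nat \<Rightarrow> 'a. range \<sigma> \<subseteq> carrier G \<longrightarrow> (\<forall>e>0. \<exists>N. \<forall>m\<ge>N. \<forall>n\<ge>N. nrm (\<sigma> m \<ominus> \<sigma> n) < e) \<longrightarrow>
       (\<exists>x\<in>carrier G. \<forall>e>0. \<exists>N. \<forall>n\<ge>N. nrm (\<sigma> n \<ominus> x) < e))"
proof -
  have MC: "metric.MCauchy \<sigma> \<longleftrightarrow>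
      range \<sigma> \<subseteq> carrier G \<and> (\<forall>e>0. \<exists>N. \<forall>m\<ge>N. \<forall>n\<ge>N. nrm (\<sigma> m \<ominus> \<sigma> n) < e)" for \<sigma>
    unfolding metric.MCauchy_def norm_dist_def
    by (rule conj_cong[OF refl]) (simp add: range_subsetD)
  have lim: "limitin metric.mtopology \<sigma> x sequentially \<longleftrightarrow>
      x \<in> carrier G \<and> (\<forall>e>0. \<exists>N. \<forall>n\<ge>N. nrm (\<sigma> n \<ominus> x) < e)"
    if "range \<sigma> \<subseteq> carrier G" for \<sigma> x
    unfolding metric.limit_metric_sequentially norm_dist_def
    by (rule conj_cong[OF refl]) (use that in \<open>auto simp: range_subsetD\<close>)
  show ?thesis
    unfolding norm_complete_def metric.mcomplete_def
  proof (rule all_cong1)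
    show "(metric.MCauchy \<sigma> \<longrightarrow> (\<exists>x. limitin metric.mtopology \<sigma> x sequentially)) \<longleftrightarrow>
      (range \<sigma> \<subseteq> carrier G \<longrightarrow> (\<forall>e>0. \<exists>N. \<forall>m\<ge>N. \<forall>n\<ge>N. nrm (\<sigma> m \<ominus> \<sigma> n) < e) \<longrightarrow>
       (\<exists>x\<in>carrier G. \<forall>e>0. \<exists>N. \<forall>n\<ge>N. nrm (\<sigma> n \<ominus> x) < e))" for \<sigma>
      by (cases "range \<sigma> \<subseteq> carrier G") (simp_all only: MC lim Bex_def simp_thms)
  qed
qed

lemma has_norm_sum_iff:
  assumes "\<And>i. f i \<in> carrier G"
  shows "has_norm_sum G nrm f UNIV x \<longleftrightarrow> x \<in> carrier G \<and>
    (\<forall>e>0. \<exists>F. finite F \<and> (\<forall>H. finite H \<and> F \<subseteq> H \<longrightarrow> nrm (finsum G f H \<ominus> x) < e))"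
  unfolding has_norm_sum_def norm_topology_def metric.limitin_metric norm_dist_def
    eventually_finite_subsets_at_top
  using assms by (auto simp: Pi_I)

lemma has_norm_sumI:
  assumes "\<And>i. f i \<in> carrier G" "x \<in> carrier G"
    and "\<And>e. 0 < e \<Longrightarrow> \<exists>F. finite F \<and> (\<forall>H. finite H \<and> F \<subseteq> H \<longrightarrow> nrm (finsum G f H \<ominus> x) < e)"
  shows "has_norm_sum G nrm f UNIV x"
  using assms by (simp add: has_norm_sum_iff)

lemma has_norm_sumE:
  assumes "has_norm_sum G nrm f UNIV x" "\<And>i. f i \<in> carrier G" "0 < e"
  obtains F where "finite F" "\<And>H. finite H \<Longrightarrow> F \<subseteq> H \<Longrightarrow> nrm (finsum G f H \<ominus> x) < e"
  using assms by (auto simp: has_norm_sum_iff)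

lemma has_norm_sum_closed: "has_norm_sum G nrm f UNIV x \<Longrightarrow> x \<in> carrier G"
  unfolding has_norm_sum_def norm_topology_def by (rule metric.limitin_mspace)

lemma has_norm_sum_unique:
  "has_norm_sum G nrm f UNIV x \<Longrightarrow> has_norm_sum G nrm f UNIV y \<Longrightarrow> x = y"
  unfolding has_norm_sum_def norm_topology_def
  by (rule metric.limitin_metric_unique) auto

lemma norm_sum_eqI: "has_norm_sum G nrm f UNIV x \<Longrightarrow> norm_sum G nrm f UNIV = x"
  unfolding norm_sum_def using has_norm_sum_unique by blast

lemma nrm_finsum_le:
  assumes "\<And>i. i \<in> F \<Longrightarrow> f i \<in> carrier G" "\<And>i. i \<in> F \<Longrightarrow> nrm (f i) \<le> e" "0 \<le> e"
  shows "nrm (finsum G f F) \<le> e"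
  using assms
proof (induction F rule: infinite_finite_induct)
  case (insert a F)
  have f: "f \<in> F \<rightarrow> carrier G" "f a \<in> carrier G"
    using insert.prems by auto
  have "nrm (finsum G f F) \<le> e" "nrm (f a) \<le> e"
    using insert by auto
  then show ?case
    using nrm_add[of "f a" "finsum G f F"] f insert.hyps by (simp add: finsum_insert)
qed (auto simp: nrm_zero)

lemma finsum_minus_subset:
  assumes "finite H" "F \<subseteq> H" "\<And>i. f i \<in> carrier G"
  shows "finsum G f H \<ominus> finsum G f F = finsum G f (H - F)"
proof -
  have fin: "finite F" using assms finite_subset by blast
  have "finsum G f (F \<union> (H - F)) = finsum G f F \<oplus> finsum G f (H - F)"
    by (rule finsum_Un_disjoint) (use assms fin in auto)
  moreover have "F \<union> (H - F) = H" using assms by auto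
  ultimately have "finsum G f H = finsum G f F \<oplus> finsum G f (H - F)" by simp
  moreover have "finsum G f F \<in> carrier G" "finsum G f (H - F) \<in> carrier G"
    using assms by (auto intro: finsum_closed)
  ultimately show ?thesis
    by (simp add: minus_eq a_assoc a_comm r_neg1)
qed

text \<open>Enlarging \<open>F\<close> to a finite set whose partial sum is close to
  \<open>x\<close> adds only terms of norm at most \<open>e\<close>, hence changes the sum by at
  most \<open>e\<close>. The case \<open>F = {}\<close> bounds the norm of the whole sum.\<close>

lemma nrm_finsum_minus_le:
  assumes x: "has_norm_sum G nrm f UNIV x" and f: "\<And>i. f i \<in> carrier G"
    and F: "finite F" and le: "\<And>i. i \<notin> F \<Longrightarrow> nrm (f i) \<le> e" "0 \<le> e"
  shows "nrm (finsum G f F \<ominus> x) \<le> e"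
proof (rule field_le_epsilon)
  fix \<eta> :: real assume "0 < \<eta>"
  then obtain H where H: "finite H" "\<And>H'. finite H' \<Longrightarrow> H \<subseteq> H' \<Longrightarrow> nrm (finsum G f H' \<ominus> x) < \<eta>"
    using has_norm_sumE[OF x f] by blast
  let ?H = "H \<union> F"
  have fin: "finite ?H" using H F by simp
  have car: "finsum G f S \<in> carrier G" for S
    using f by (auto intro: finsum_closed)
  have xc: "x \<in> carrier G" using x by (rule has_norm_sum_closed)
  have "nrm (finsum G f (?H - F)) \<le> e"
    using f le by (intro nrm_finsum_le) auto
  then have "nrm (finsum G f F \<ominus> finsum G f ?H) \<le> e"
    using finsum_minus_subset[OF fin, of F f] f nrm_minus_commute[OF car car, of F ?H] by simp
  moreover have "nrm (finsum G f ?H \<ominus> x) < \<eta>"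
    using H(2)[of ?H] fin by simp
  ultimately show "nrm (finsum G f F \<ominus> x) \<le> e + \<eta>"
    using nrm_triangle[OF car car xc, of F ?H] le(2) \<open>0 < \<eta>\<close> by linarith
qed

lemma has_norm_sum_add:
  assumes x: "has_norm_sum G nrm f UNIV x" and y: "has_norm_sum G nrm g UNIV y"
    and f: "\<And>i. f i \<in> carrier G" and g: "\<And>i. g i \<in> carrier G"
  shows "has_norm_sum G nrm (\<lambda>i. f i \<oplus> g i) UNIV (x \<oplus> y)"
proof (rule has_norm_sumI)
  have xy: "x \<in> carrier G" "y \<in> carrier G"
    using x y has_norm_sum_closed by auto
  then show "x \<oplus> y \<in> carrier G" by simp
  show "f i \<oplus> g i \<in> carrier G" for i using f g by simp
  fix e :: real assume e: "0 < e"
  obtain F where F: "finite F" "\<And>H. finite H \<Longrightarrow> F \<subseteq> H \<Longrightarrow> nrm (finsum G f H \<ominus> x) < e"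
    using has_norm_sumE[OF x f e] by blast
  obtain F' where F': "finite F'" "\<And>H. finite H \<Longrightarrow> F' \<subseteq> H \<Longrightarrow> nrm (finsum G g H \<ominus> y) < e"
    using has_norm_sumE[OF y g e] by blast
  have "nrm (finsum G (\<lambda>i. f i \<oplus> g i) H \<ominus> (x \<oplus> y)) < e" if H: "finite H" "F \<union> F' \<subseteq> H" for H
  proof -
    have car: "finsum G f H \<in> carrier G" "finsum G g H \<in> carrier G"
      using f g by (auto intro: finsum_closed)
    have "finsum G (\<lambda>i. f i \<oplus> g i) H = finsum G f H \<oplus> finsum G g H"
      using f g by (intro finsum_addf) auto
    then have "finsum G (\<lambda>i. f i \<oplus> g i) H \<ominus> (x \<oplus> y) = (finsum G f H \<ominus> x) \<oplus> (finsum G g H \<ominus> y)"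
      using car xy by (simp add: minus_eq minus_add a_ac)
    moreover have "nrm (finsum G f H \<ominus> x) < e" "nrm (finsum G g H \<ominus> y) < e"
      using H F(2)[of H] F'(2)[of H] by auto
    ultimately show ?thesis
      using nrm_add[of "finsum G f H \<ominus> x" "finsum G g H \<ominus> y"] car xy by simp
  qed
  then show "\<exists>F. finite F \<and> (\<forall>H. finite H \<and> F \<subseteq> H \<longrightarrow> nrm (finsum G (\<lambda>i. f i \<oplus> g i) H \<ominus> (x \<oplus> y)) < e)"
    using F(1) F'(1) by (intro exI[of _ "F \<union> F'"]) auto
qed

section \<open>Bounded additive maps and infinite sums\<close>

context
  fixes T :: "'a \<Rightarrow> 'a"
  assumes T: "\<And>x. x \<in> carrier G \<Longrightarrow> T x \<in> carrier G"
    and add: "\<And>x y. \<lbrakk>x \<in> carrier G; y \<in> carrier G\<rbrakk> \<Longrightarrow> T (x \<oplus> y) = T x \<oplus> T y"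
begin

lemma additive_map_zero: "T \<zero> = \<zero>"
  using add[of \<zero> \<zero>] T[of \<zero>] by (metis add.l_cancel_one' l_zero zero_closed)

lemma additive_map_uminus: "x \<in> carrier G \<Longrightarrow> T (\<ominus> x) = \<ominus> T x"
  using add[of "\<ominus> x" x] additive_map_zero T add
  by (metis a_inv_closed l_neg minus_equality zero_closed)

lemma additive_map_minus: "\<lbrakk>x \<in> carrier G; y \<in> carrier G\<rbrakk> \<Longrightarrow> T (x \<ominus> y) = T x \<ominus> T y"
  by (simp add: minus_eq add additive_map_uminus)

lemma additive_map_int_mult:
  assumes "x \<in> carrier G"
  shows "T ([(n::int)] \<cdot>\<^bsub>G\<^esub> x) = [n] \<cdot>\<^bsub>G\<^esub> T x"
proof -
  have nat: "T ([(m::nat)] \<cdot>\<^bsub>G\<^esub> x) = [m] \<cdot>\<^bsub>G\<^esub> T x" for m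
    by (induction m) (use assms additive_map_zero T add in auto)
  show ?thesis
    by (cases "0 \<le> n") (use nat assms additive_map_uminus in \<open>auto simp: add_pow_int_ge add_pow_int_lt\<close>)
qed

lemma finsum_additive_map:
  assumes f: "\<And>i. f i \<in> carrier G"
  shows "finsum G (\<lambda>i. T (f i)) F = T (finsum G f F)"
proof (induction F rule: infinite_finite_induct)
  case (insert a F)
  then show ?case
    using f by (simp add: finsum_insert T add Pi_I finsum_closed)
qed (use additive_map_zero in auto)

text \<open>A bounded additive map is continuous and commutes with finite sums. It is applied to
  \<delta>, to multiplication by a fixed element on either side, and to scalar
  multiplication.\<close>

lemma has_norm_sum_map:
  assumes x: "has_norm_sum G nrm f UNIV x" and f: "\<And>i. f i \<in> carrier G"
    and bdd: "\<And>x. x \<in> carrier G \<Longrightarrow> nrm (T x) \<le> C * nrm x"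
  shows "has_norm_sum G nrm (\<lambda>i. T (f i)) UNIV (T x)"
proof (rule has_norm_sumI)
  have xc: "x \<in> carrier G" using x has_norm_sum_closed by auto
  then show "T x \<in> carrier G" by (rule T)
  show "T (f i) \<in> carrier G" for i using f T by simp
  fix e :: real assume e: "0 < e"
  \<comment> \<open>The sign of \<open>C\<close> is unknown, and the tolerance \<open>e\<close> is
    to be divided by a positive bound.\<close>
  have C: "0 < \<bar>C\<bar> + 1" by simp
  obtain F where F: "finite F"
      "\<And>H. finite H \<Longrightarrow> F \<subseteq> H \<Longrightarrow> nrm (finsum G f H \<ominus> x) < e / (\<bar>C\<bar> + 1)"
    using has_norm_sumE[OF x f, of "e / (\<bar>C\<bar> + 1)"] e by (metis C divide_pos_pos)
  have "nrm (finsum G (\<lambda>i. T (f i)) H \<ominus> T x) < e" if H: "finite H" "F \<subseteq> H" for H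
  proof -
    have car: "finsum G f H \<in> carrier G" using f by (auto intro: finsum_closed)
    let ?y = "finsum G f H \<ominus> x"
    have yc: "?y \<in> carrier G" using car xc by simp
    have "nrm (T ?y) \<le> C * nrm ?y"
      using bdd yc by blast
    also have "\<dots> \<le> (\<bar>C\<bar> + 1) * nrm ?y"
      using nrm_nonneg[OF yc] by (intro mult_right_mono) auto
    also have "\<dots> < e"
      using F(2)[OF H] C by (simp add: less_divide_eq mult.commute)
    finally show ?thesis
      using additive_map_minus[OF car xc] finsum_additive_map[of f H, OF f] by simp
  qed
  then show "\<exists>F. finite F \<and> (\<forall>H. finite H \<and> F \<subseteq> H \<longrightarrow> nrm (finsum G (\<lambda>i. T (f i)) H \<ominus> T x) < e)"
    using F(1) by blast
qed

end

text \<open>Moves a series along an injection, padding with zeros. With \<open>Suc\<close> it aligns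
  the two series in Pascal's rule; with the successor map on the integers it shifts the outer sum of
  a star product.\<close>

lemma has_norm_sum_extend_zero:
  assumes x: "has_norm_sum G nrm (\<lambda>i. f (h i)) UNIV x" and f: "\<And>i. f i \<in> carrier G" and h: "inj h"
    and zero: "\<And>j. j \<notin> range h \<Longrightarrow> f j = \<zero>"
  shows "has_norm_sum G nrm f UNIV x"
proof (rule has_norm_sumI)
  show "x \<in> carrier G" using x has_norm_sum_closed by auto
  show "f i \<in> carrier G" for i by (rule f)
  fix e :: real assume e: "0 < e"
  obtain F where F: "finite F"
      "\<And>H. finite H \<Longrightarrow> F \<subseteq> H \<Longrightarrow> nrm (finsum G (\<lambda>i. f (h i)) H \<ominus> x) < e"
    using has_norm_sumE[OF x f e] by blast
  have "nrm (finsum G f H \<ominus> x) < e" if H: "finite H" "h ` F \<subseteq> H" for H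
  proof -
    have "finsum G f H = finsum G f (h ` (h -` H))"
      using H(1) f zero by (intro add.finprod_mono_neutral_cong_right) auto
    also have "\<dots> = finsum G (\<lambda>i. f (h i)) (h -` H)"
      using f h by (intro finsum_reindex) (auto intro: inj_on_subset)
    finally show ?thesis
      using F(2)[of "h -` H"] H finite_vimageI[OF H(1) h] by auto
  qed
  then show "\<exists>F. finite F \<and> (\<forall>H. finite H \<and> F \<subseteq> H \<longrightarrow> nrm (finsum G f H \<ominus> x) < e)"
    using F(1) by (intro exI[of _ "h ` F"]) auto
qed

lemma has_norm_sum_single:
  assumes "f a \<in> carrier G" "\<And>i. i \<noteq> a \<Longrightarrow> f i = \<zero>"
  shows "has_norm_sum G nrm f UNIV (f a)"
proof (rule has_norm_sumI)
  show f: "f i \<in> carrier G" for i using assms by (cases "i = a") auto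
  show "f a \<in> carrier G" by fact
  fix e :: real assume e: "0 < e"
  have "nrm (finsum G f H \<ominus> f a) < e" if H: "finite H" "{a} \<subseteq> H" for H
  proof -
    have "finsum G f H \<ominus> finsum G f {a} = finsum G f (H - {a})"
      using H f by (intro finsum_minus_subset)
    moreover have "finsum G f (H - {a}) = \<zero>"
      using assms(2) by (intro add.finprod_one_eqI) auto
    moreover have "finsum G f {a} = f a"
      using f finsum_insert[of "{}" a f] by simp
    ultimately show ?thesis using e nrm_zero by simp
  qed
  then show "\<exists>F. finite F \<and> (\<forall>H. finite H \<and> F \<subseteq> H \<longrightarrow> nrm (finsum G f H \<ominus> f a) < e)"
    by (intro exI[of _ "{a}"]) auto
qed

lemma finsum_swap:
  assumes "finite S" "finite T" "\<And>i j. f i j \<in> carrier G"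
  shows "finsum G (\<lambda>i. finsum G (f i) T) S = finsum G (\<lambda>j. finsum G (\<lambda>i. f i j) S) T"
  using assms(1)
proof induction
  case empty
  then show ?case by simp
next
  case (insert a S)
  have c: "finsum G (f i) T \<in> carrier G" "finsum G (\<lambda>i. f i j) S \<in> carrier G" for i j
    using assms(3) by (auto intro: finsum_closed)
  have "finsum G (\<lambda>i. finsum G (f i) T) (insert a S) =
      finsum G (f a) T \<oplus> finsum G (\<lambda>j. finsum G (\<lambda>i. f i j) S) T"
    using insert c by (simp add: finsum_insert Pi_I)
  also have "\<dots> = finsum G (\<lambda>j. f a j \<oplus> finsum G (\<lambda>i. f i j) S) T"
    using assms(3) c by (intro finsum_addf[symmetric]) auto
  also have "(\<lambda>j. f a j \<oplus> finsum G (\<lambda>i. f i j) S) = (\<lambda>j. finsum G (\<lambda>i. f i j) (insert a S))"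
    using insert assms(3) by (intro ext) (simp add: finsum_insert Pi_I)
  finally show ?case .
qed

end

locale complete_nonarch_group = nonarch_normed_group +
  assumes nrm_complete: "norm_complete G nrm"
begin

text \<open>The superlevel sets \<open>F n\<close> of threshold 1/(n+1) are finite and increasing.
  Any finite set containing \<open>F n\<close> changes the partial sum by at most that threshold.
  This makes the partial sums over \<open>F n\<close> Cauchy, and the same bound turns their limit
  into the limit of the net of all finite partial sums.\<close>

lemma norm_summable_vanishing:
  assumes f: "\<And>i. f i \<in> carrier G" and van: "vanishing (\<lambda>i. nrm (f i))"
  shows "norm_summable G nrm f UNIV"
proof -
  define F where "F n = {i. inverse (real (Suc n)) \<le> nrm (f i)}" for n
  have fin: "finite (F n)" for n
    unfolding F_def using van by (intro vanishingD) auto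
  have mono: "F m \<subseteq> F n" if "m \<le> n" for m n
  proof -
    have "inverse (real (Suc n)) \<le> inverse (real (Suc m))"
      using that by (intro le_imp_inverse_le) auto
    then show ?thesis unfolding F_def using order_trans by blast
  qed
  have car: "finsum G f S \<in> carrier G" for S
    using f by (auto intro: finsum_closed)
  have tail: "nrm (finsum G f H \<ominus> finsum G f (F n)) \<le> inverse (real (Suc n))"
    if "finite H" "F n \<subseteq> H" for H n
  proof -
    have "nrm (finsum G f (H - F n)) \<le> inverse (real (Suc n))"
      using f by (intro nrm_finsum_le) (auto simp: F_def)
    then show ?thesis
      using finsum_minus_subset[of H "F n" f] that f by simp
  qed
  have "\<exists>N. \<forall>m\<ge>N. \<forall>n\<ge>N. nrm (finsum G f (F m) \<ominus> finsum G f (F n)) < e" if "0 < e" for e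
  proof -
    obtain N where N: "inverse (real (Suc N)) < e"
      using reals_Archimedean[OF \<open>0 < e\<close>] by blast
    have "nrm (finsum G f (F m) \<ominus> finsum G f (F n)) < e" if "N \<le> m" "N \<le> n" for m n
    proof -
      have "nrm (finsum G f (F m) \<ominus> finsum G f (F N)) < e"
        "nrm (finsum G f (F n) \<ominus> finsum G f (F N)) < e"
        using tail[OF fin mono[OF that(1)]] tail[OF fin mono[OF that(2)]] N by simp_all
      then show ?thesis
        using nrm_triangle[OF car car car, of "F m" "F n" "F N"]
          nrm_minus_commute[OF car car, of "F N" "F n"] by simp
    qed
    then show ?thesis by blast
  qed
  then obtain x where xc: "x \<in> carrier G"
      and x: "\<And>e. 0 < e \<Longrightarrow> \<exists>N. \<forall>n\<ge>N. nrm (finsum G f (F n) \<ominus> x) < e"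
    using nrm_complete[unfolded norm_complete_iff, rule_format, of "\<lambda>n. finsum G f (F n)"] car
    by blast
  have "has_norm_sum G nrm f UNIV x"
  proof (rule has_norm_sumI[OF f xc])
    fix e :: real assume "0 < e"
    then obtain N where N: "\<forall>n\<ge>N. nrm (finsum G f (F n) \<ominus> x) < e"
      using x by blast
    obtain N' where N': "inverse (real (Suc N')) < e"
      using reals_Archimedean[OF \<open>0 < e\<close>] by blast
    let ?n = "max N N'"
    have le: "inverse (real (Suc ?n)) \<le> inverse (real (Suc N'))"
      by (intro le_imp_inverse_le) auto
    have "nrm (finsum G f (F ?n) \<ominus> x) < e"
      using N by simp
    then have "nrm (finsum G f H \<ominus> x) < e" if "finite H" "F ?n \<subseteq> H" for H
      using nrm_triangle[OF car car xc, of H "F ?n"] tail[OF that] le N'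
      by linarith
    then show "\<exists>F. finite F \<and> (\<forall>H. finite H \<and> F \<subseteq> H \<longrightarrow> nrm (finsum G f H \<ominus> x) < e)"
      using fin by blast
  qed
  then show ?thesis
    unfolding norm_summable_def by blast
qed

lemma has_norm_sum_vanishing:
  assumes "\<And>i. f i \<in> carrier G" "vanishing (\<lambda>i. nrm (f i))"
  shows "has_norm_sum G nrm f UNIV (norm_sum G nrm f UNIV)"
  using norm_summable_vanishing[OF assms] norm_sum_eqI unfolding norm_summable_def by blast

lemma norm_sum_closed:
  "\<lbrakk>\<And>i. f i \<in> carrier G; vanishing (\<lambda>i. nrm (f i))\<rbrakk> \<Longrightarrow> norm_sum G nrm f UNIV \<in> carrier G"
  using has_norm_sum_vanishing has_norm_sum_closed by blast

text \<open>If all terms were strictly smaller than the sum, so would be their supremum, since only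
  finitely many terms exceed half the norm of the sum; this contradicts the ultrametric bound. The
  existential form, stronger than a bound by a supremum, is the input for
  \<open>vanishing_dominated\<close>.\<close>

lemma nrm_norm_sum_le_term:
  assumes f: "\<And>i. f i \<in> carrier G" and van: "vanishing (\<lambda>i. nrm (f i))"
  shows "\<exists>i. nrm (norm_sum G nrm f UNIV) \<le> nrm (f i)"
proof (rule ccontr)
  let ?e = "nrm (norm_sum G nrm f UNIV)"
  assume "\<nexists>i. ?e \<le> nrm (f i)"
  then have lt: "nrm (f i) < ?e" for i
    using not_le by blast
  have e: "0 < ?e"
    using lt[of undefined] nrm_nonneg[OF f, of undefined] by linarith
  let ?F = "{i. ?e / 2 \<le> nrm (f i)}"
  \<comment> \<open>The extra element \<open>?e / 2\<close> dominates the possibly infinitely many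
    terms outside \<open>?F\<close>.\<close>
  let ?S = "insert (?e / 2) ((\<lambda>i. nrm (f i)) ` ?F)"
  have fin: "finite ?S"
    using vanishingD[OF van, of "?e / 2"] e by simp
  have "Max ?S < ?e"
    using fin e lt by (subst Max_less_iff) auto
  moreover have "nrm (f i) \<le> Max ?S" for i
  proof (cases "i \<in> ?F")
    case True
    then show ?thesis using fin by (intro Max_ge) auto
  next
    case False
    then have "nrm (f i) \<le> ?e / 2" by simp
    also have "\<dots> \<le> Max ?S" using fin by (intro Max_ge) auto
    finally show ?thesis .
  qed
  moreover have "0 \<le> Max ?S"
    using e fin Max_ge[of ?S "?e / 2"] by simp
  ultimately have "nrm (finsum G f {} \<ominus> norm_sum G nrm f UNIV) < ?e"
    using nrm_finsum_minus_le[OF has_norm_sum_vanishing[OF f van] f, of "{}" "Max ?S"] by simp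
  then show False
    using nrm_uminus norm_sum_closed[OF f van] by (simp add: minus_eq)
qed

text \<open>Both iterated sums lie within \<open>e\<close> of the same finite double sum, taken over
  a rectangle that contains all pairs with term of norm at least \<open>e\<close>. The claim
  \<open>approx\<close> is stated for a general \<open>g\<close> in order to be applied to
  \<open>f\<close> and to its transpose.\<close>

lemma norm_sum_swap:
  assumes f: "\<And>i j. f i j \<in> carrier G" and van: "vanishing (\<lambda>(i, j). nrm (f i j))"
  shows "norm_sum G nrm (\<lambda>i. norm_sum G nrm (f i) UNIV) UNIV =
         norm_sum G nrm (\<lambda>j. norm_sum G nrm (\<lambda>i. f i j) UNIV) UNIV" (is "?x = ?y")
proof -
  have approx: "norm_sum G nrm (\<lambda>i. norm_sum G nrm (g i) UNIV) UNIV \<in> carrier G \<and>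
      nrm (finsum G (\<lambda>i. finsum G (g i) T) S
        \<ominus> norm_sum G nrm (\<lambda>i. norm_sum G nrm (g i) UNIV) UNIV) \<le> e"
    if g: "\<And>i j. g i j \<in> carrier G" and vg: "vanishing (\<lambda>(i, j). nrm (g i j))"
      and fin: "finite S" "finite T" and e: "0 < e"
      and le: "\<And>i j. (i, j) \<notin> S \<times> T \<Longrightarrow> nrm (g i j) \<le> e"
    for g :: "'i \<Rightarrow> 'j \<Rightarrow> 'a" and S T e
  proof -
    have v1: "vanishing (\<lambda>j. nrm (g i j))" for i
      using vanishing_compose_inj[OF vg, of "\<lambda>j. (i, j)"] by (simp add: inj_def)
    let ?s = "\<lambda>i. norm_sum G nrm (g i) UNIV"
    note hs = has_norm_sum_vanishing[OF g v1]
    have sc: "?s i \<in> carrier G" for i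
      by (rule norm_sum_closed[OF g v1])
    have sle: "\<exists>j. nrm (?s i) \<le> nrm (g i j)" for i
      by (rule nrm_norm_sum_le_term[OF g v1])
    have vs: "vanishing (\<lambda>i. nrm (?s i))"
    proof (rule vanishing_dominated[OF vg, of fst])
      show "\<exists>p. fst p = i \<and> nrm (?s i) \<le> 1 * (case p of (i, j) \<Rightarrow> nrm (g i j))" for i
        using sle[of i] by auto
    qed simp
    let ?X = "norm_sum G nrm ?s UNIV"
    have Xc: "?X \<in> carrier G"
      by (rule norm_sum_closed[OF sc vs])
    have fc: "finsum G (g i) T \<in> carrier G" for i
      using g by (auto intro: finsum_closed)
    have fsc: "finsum G ?s S \<in> carrier G" "finsum G (\<lambda>i. finsum G (g i) T) S \<in> carrier G"
      using sc fc by (auto intro: finsum_closed)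
    have "nrm (finsum G ?s S \<ominus> ?X) \<le> e"
    proof (rule nrm_finsum_minus_le[OF has_norm_sum_vanishing[OF sc vs] sc fin(1)])
      fix i assume "i \<notin> S"
      then have "nrm (g i j) \<le> e" for j
        using le[of i j] by simp
      then show "nrm (?s i) \<le> e"
        using sle[of i] order_trans by blast
    qed (use e in simp)
    \<comment> \<open>Truncating each row to \<open>T\<close> costs at most \<open>e\<close>, and
      the ultrametric inequality adds these errors over \<open>S\<close> without a factor for the
      size of \<open>S\<close>.\<close>
    moreover have "nrm (finsum G (\<lambda>i. finsum G (g i) T) S \<ominus> finsum G ?s S) \<le> e"
    proof -
      have part: "nrm (finsum G (g i) T \<ominus> ?s i) \<le> e" for i
        by (rule nrm_finsum_minus_le[OF hs g fin(2)]) (use le e in auto)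
      have "finsum G (\<lambda>i. (finsum G (g i) T \<ominus> ?s i) \<oplus> ?s i) S =
          finsum G (\<lambda>i. finsum G (g i) T \<ominus> ?s i) S \<oplus> finsum G ?s S"
        using fc sc by (intro finsum_addf) auto
      moreover have "(finsum G (g i) T \<ominus> ?s i) \<oplus> ?s i = finsum G (g i) T" for i
        using fc[of i] sc[of i] by (simp add: minus_eq a_assoc l_neg)
      ultimately have "finsum G (\<lambda>i. finsum G (g i) T) S =
          finsum G (\<lambda>i. finsum G (g i) T \<ominus> ?s i) S \<oplus> finsum G ?s S"
        by simp
      moreover have "finsum G (\<lambda>i. finsum G (g i) T \<ominus> ?s i) S \<in> carrier G"
        using fc sc by (auto intro: finsum_closed)
      ultimately have "finsum G (\<lambda>i. finsum G (g i) T) S \<ominus> finsum G ?s S =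
          finsum G (\<lambda>i. finsum G (g i) T \<ominus> ?s i) S"
        using fsc by (simp add: minus_eq a_assoc r_neg)
      also have "nrm \<dots> \<le> e"
        using part fc sc e by (intro nrm_finsum_le) auto
      finally show ?thesis .
    qed
    ultimately show ?thesis
      using nrm_triangle[OF fsc(2) fsc(1) Xc] Xc by linarith
  qed
  have van': "vanishing (\<lambda>(j, i). nrm (f i j))"
    using vanishing_compose_inj[OF van, of prod.swap] by (simp add: case_prod_unfold)
  have close: "?x \<in> carrier G \<and> ?y \<in> carrier G \<and> nrm (?x \<ominus> ?y) \<le> e" if e: "0 < e" for e
  proof -
    let ?F = "{(i, j). e \<le> nrm (f i j)}"
    have finF: "finite ?F"
      using vanishingD[OF van e] by (simp add: case_prod_unfold)
    let ?S = "fst ` ?F" and ?T = "snd ` ?F"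
    have fin: "finite ?S" "finite ?T" using finF by auto
    have le: "nrm (f i j) \<le> e" if "(i, j) \<notin> ?S \<times> ?T" for i j
    proof (rule ccontr)
      assume "\<not> nrm (f i j) \<le> e"
      then have "(i, j) \<in> ?F" by simp
      then have "i \<in> ?S" "j \<in> ?T" by force+
      with that show False by simp
    qed
    let ?z = "finsum G (\<lambda>i. finsum G (f i) ?T) ?S"
    have zc: "?z \<in> carrier G"
      using f by (auto intro!: finsum_closed)
    have x: "?x \<in> carrier G" "nrm (?z \<ominus> ?x) \<le> e"
      using approx[OF f van fin e le] by auto
    have "?y \<in> carrier G \<and> nrm (finsum G (\<lambda>j. finsum G (\<lambda>i. f i j) ?S) ?T \<ominus> ?y) \<le> e"
      by (rule approx[OF f van' fin(2,1) e]) (use le in auto)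
    then have y: "?y \<in> carrier G" "nrm (?z \<ominus> ?y) \<le> e"
      using finsum_swap[OF fin f] by auto
    show ?thesis
      using nrm_triangle[OF x(1) zc y(1)] x y nrm_minus_commute[OF x(1) zc] by simp
  qed
  have xy: "?x \<in> carrier G" "?y \<in> carrier G" using close[of 1] by auto
  have "nrm (?x \<ominus> ?y) \<le> 0"
    by (rule field_le_epsilon) (use close in auto)
  then show ?thesis
    using nrm_minus_eq_0_iff[OF xy] nrm_nonneg[of "?x \<ominus> ?y"] xy by (simp add: minus_closed)
qed

end


section \<open>Integer binomial coefficients\<close>

text \<open>Pascal's rule multiplied by the factorial: the left side is \<open>i + 1\<close> times
  the product of length \<open>m\<close>, and i + 1 = (i - m) + (m + 1).\<close>

lemma falling_prod_Suc_Suc: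
  fixes i :: int
  shows "(\<Prod>l<Suc m. (i + 1) - int l) = (\<Prod>l<Suc m. i - int l) + int (Suc m) * (\<Prod>l<m. i - int l)"
proof -
  have "(\<Prod>l<Suc m. (i + 1) - int l) = (i + 1) * (\<Prod>l<m. i - int l)"
    by (simp add: prod.lessThan_Suc_shift del: prod.lessThan_Suc)
  then show ?thesis
    by (simp add: algebra_simps)
qed

text \<open>Justifies the integer division in \<open>int_binom\<close>. Inside the induction on
  \<open>m\<close> runs an induction on \<open>i\<close> from 0 in both directions: at 0 the product
  has a zero factor, and by Pascal's rule each step in \<open>i\<close> changes it by a multiple of
  the factorial, thanks to the outer hypothesis.\<close>

lemma fact_dvd_falling_prod: "(fact m :: int) dvd (\<Prod>l<m. i - int l)"
proof (induction m arbitrary: i)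
  case 0
  then show ?case by simp
next
  case (Suc m)
  have step: "fact (Suc m) dvd int (Suc m) * (\<Prod>l<m. i - int l)" for i
    using Suc[of i] by (simp add: mult_dvd_mono del: of_nat_Suc)
  show ?case
  proof (induction i rule: int_induct[where k = 0])
    case base
    have "(\<Prod>l<Suc m. 0 - int l) = 0"
      by (intro prod_zero) auto
    then show ?case by (simp only: dvd_0_right)
  next
    case (step1 i)
    then show ?case
      unfolding falling_prod_Suc_Suc using step dvd_add by blast
  next
    case (step2 i)
    have "(\<Prod>l<Suc m. i - int l) = (\<Prod>l<Suc m. (i - 1) - int l) + int (Suc m) * (\<Prod>l<m. (i - 1) - int l)"
      using falling_prod_Suc_Suc[where i = "i - 1"] by simp
    then show ?case
      using step2(2) step[of "i - 1"] by (metis dvd_add_left_iff)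
  qed
qed

lemma int_binom_mult_fact: "int_binom i m * fact m = (\<Prod>l<m. i - int l)"
  unfolding int_binom_def using fact_dvd_falling_prod by simp

lemma int_binom_0_right: "int_binom i 0 = 1"
  by (simp add: int_binom_def)

lemma int_binom_0_Suc: "int_binom 0 (Suc m) = 0"
proof -
  have "(\<Prod>l<Suc m. 0 - int l) = 0"
    by (intro prod_zero) auto
  then show ?thesis
    by (simp only: int_binom_def div_0)
qed

lemma int_binom_Suc_Suc: "int_binom (i + 1) (Suc m) = int_binom i (Suc m) + int_binom i m"
proof -
  have "int_binom (i + 1) (Suc m) * fact (Suc m) =
      int_binom i (Suc m) * fact (Suc m) + int (Suc m) * (int_binom i m * fact m)"
    using falling_prod_Suc_Suc by (simp only: int_binom_mult_fact)
  also have "\<dots> = (int_binom i (Suc m) + int_binom i m) * fact (Suc m)"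
    by (simp add: algebra_simps)
  finally show ?thesis
    by simp
qed


section \<open>The star product\<close>

text \<open>The boundedness and spectral hypotheses enter as explicit constants: \<open>C\<close>
  for the multiplication, \<open>M\<close> and \<rho> for the powers of \<delta>. Scalars are absent
  because the ring laws of the star product involve only the ring of coefficients.\<close>

locale twisted_annulus = ring A + complete_nonarch_group A nrm
  for A (structure) and nrm :: "'a \<Rightarrow> real" +
  fixes \<delta> :: "'a \<Rightarrow> 'a" and s r C M \<rho> :: real
  assumes nrm_mult: "\<lbrakk>x \<in> carrier A; y \<in> carrier A\<rbrakk> \<Longrightarrow> nrm (x \<otimes> y) \<le> C * nrm x * nrm y"
    and C_nonneg: "0 \<le> C"
    and delta_closed: "x \<in> carrier A \<Longrightarrow> \<delta> x \<in> carrier A"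
    and delta_add: "\<lbrakk>x \<in> carrier A; y \<in> carrier A\<rbrakk> \<Longrightarrow> \<delta> (x \<oplus> y) = \<delta> x \<oplus> \<delta> y"
    and delta_mult: "\<lbrakk>x \<in> carrier A; y \<in> carrier A\<rbrakk> \<Longrightarrow> \<delta> (x \<otimes> y) = \<delta> x \<otimes> y \<oplus> x \<otimes> \<delta> y"
    and nrm_delta_pow: "x \<in> carrier A \<Longrightarrow> nrm ((\<delta> ^^ m) x) \<le> M * \<rho> ^ m * nrm x"
    and M_nonneg: "0 \<le> M" and rho_nonneg: "0 \<le> \<rho>" and rho_less: "\<rho> < s" and s_le_r: "s \<le> r"
begin

abbreviation "annulus \<equiv> annulus_carrier A nrm s r"
abbreviation "nsum f \<equiv> norm_sum A nrm f UNIV"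
abbreviation "has_nsum f \<equiv> has_norm_sum A nrm f UNIV"

abbreviation star_mult (infixl "\<star>" 70) where
  "u \<star> v \<equiv> star_product A nrm \<delta> u v"

text \<open>Left multiplication by \<open>\<partial>\<^sup>i\<close>.\<close>

definition shift :: "int \<Rightarrow> (int \<Rightarrow> 'a) \<Rightarrow> int \<Rightarrow> 'a" where
  "shift i v k = nsum (star_inner A \<delta> v k i)"

lemma star_mult_shift: "(u \<star> v) k = nsum (\<lambda>i. u i \<otimes> shift i v k)"
  by (simp add: star_product_def star_outer_def[abs_def] shift_def)

lemma s_pos: "0 < s"
  using rho_nonneg rho_less by simp

lemma radius_pos: "t \<in> {s..r} \<Longrightarrow> 0 < t"
  using s_pos by auto

lemma s_in_radii: "s \<in> {s..r}"
  using s_le_r by simp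

lemma annulus_iff:
  "u \<in> annulus \<longleftrightarrow>
     (\<forall>j. u j \<in> carrier A) \<and> (\<forall>t\<in>{s..r}. vanishing (\<lambda>j. nrm (u j) * t powi j))"
proof (cases "\<forall>j. u j \<in> carrier A")
  case True
  have "((\<lambda>j. nrm (u j) * t powi j) \<longlongrightarrow> 0) (filtercomap abs at_top) \<longleftrightarrow>
      vanishing (\<lambda>j. nrm (u j) * t powi j)" if "t \<in> {s..r}" for t
    using True radius_pos[OF that] by (intro vanishing_iff_tendsto_abs) (simp add: nrm_nonneg)
  then show ?thesis
    by (simp add: annulus_carrier_def)
qed (auto simp: annulus_carrier_def)

lemma annulus_closed: "u \<in> annulus \<Longrightarrow> u j \<in> carrier A"
  by (simp add: annulus_iff)

lemma annulus_vanishing: "u \<in> annulus \<Longrightarrow> t \<in> {s..r} \<Longrightarrow> vanishing (\<lambda>j. nrm (u j) * t powi j)"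
  by (simp add: annulus_iff)

lemma annulus_term_nonneg: "u \<in> annulus \<Longrightarrow> t \<in> {s..r} \<Longrightarrow> 0 \<le> nrm (u j) * t powi j"
  using annulus_closed nrm_nonneg radius_pos[of t] by simp

lemmas delta_int_mult = additive_map_int_mult[of \<delta>, OF delta_closed delta_add]

lemma delta_pow_closed: "x \<in> carrier A \<Longrightarrow> (\<delta> ^^ m) x \<in> carrier A"
  by (induction m) (simp_all add: delta_closed)

lemma delta_pow_add:
  "\<lbrakk>x \<in> carrier A; y \<in> carrier A\<rbrakk> \<Longrightarrow> (\<delta> ^^ m) (x \<oplus> y) = (\<delta> ^^ m) x \<oplus> (\<delta> ^^ m) y"
  by (induction m) (simp_all add: delta_add delta_pow_closed)

lemma nrm_delta: "x \<in> carrier A \<Longrightarrow> nrm (\<delta> x) \<le> M * \<rho> * nrm x"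
  using nrm_delta_pow[of x 1] by simp

lemma delta_one: "\<delta> \<one> = \<zero>"
  using delta_mult[of \<one> \<one>] delta_closed[of \<one>] by (simp add: add.l_cancel_one')

lemma delta_zero: "\<delta> \<zero> = \<zero>"
  by (rule additive_map_zero[OF delta_closed delta_add])

lemma delta_pow_zero: "(\<delta> ^^ m) \<zero> = \<zero>"
  by (induction m) (simp_all add: delta_zero)

section \<open>Estimates and convergence of the defining series\<close>

lemma inner_closed: "v \<in> annulus \<Longrightarrow> star_inner A \<delta> v k i m \<in> carrier A"
  by (simp add: star_inner_def delta_pow_closed annulus_closed)

text \<open>With \<open>l = k - i + m\<close> one has
  \<open>t powi (k - i) = t powi l / t ^ m\<close>, so the \<open>m\<close> factors \<rho> coming
  from \<delta> pair off with \<open>m\<close> factors \<open>t\<close>. The weight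
  \<open>k - i\<close> is what remains of \<open>k\<close> after the factor \<open>u i\<close> has
  taken its share \<open>t powi i\<close>.\<close>

lemma nrm_inner_le:
  assumes v: "v \<in> annulus" and t: "t \<in> {s..r}"
  shows "nrm (star_inner A \<delta> v k i m) * t powi (k - i) \<le>
    M * ((\<rho> / t) ^ m * (nrm (v (k - i + int m)) * t powi (k - i + int m)))"
proof -
  have t0: "0 < t" using t by (rule radius_pos)
  let ?x = "v (k - i + int m)"
  have x: "?x \<in> carrier A" using v by (rule annulus_closed)
  have "nrm (star_inner A \<delta> v k i m) \<le> nrm ((\<delta> ^^ m) ?x)"
    unfolding star_inner_def by (rule nrm_int_mult_le[OF delta_pow_closed[OF x]])
  also have "\<dots> \<le> M * \<rho> ^ m * nrm ?x"
    by (rule nrm_delta_pow[OF x])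
  finally have "nrm (star_inner A \<delta> v k i m) * t powi (k - i) \<le> M * \<rho> ^ m * nrm ?x * t powi (k - i)"
    using t0 by (intro mult_right_mono) auto
  also have "\<dots> = M * ((\<rho> / t) ^ m * (nrm ?x * t powi (k - i + int m)))"
    using t0 by (simp add: power_int_add power_divide)
  finally show ?thesis .
qed

lemma vanishing_ratio: "t \<in> {s..r} \<Longrightarrow> vanishing (\<lambda>m::nat. (\<rho> / t) ^ m)"
  using rho_nonneg rho_less by (intro vanishing_power) auto

text \<open>Here \<open>m\<close> and \<open>l\<close> range independently, although only pairs with
  \<open>l = k - i + m\<close> occur in a given series. Forgetting the coupling makes the family a
  product; index maps restore it later.\<close>

lemma vanishing_kernel:
  assumes "v \<in> annulus" "t \<in> {s..r}"
  shows "vanishing (\<lambda>(m::nat, l). (\<rho> / t) ^ m * (nrm (v l) * t powi l))"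
  by (intro vanishing_prod vanishing_ratio annulus_vanishing annulus_term_nonneg)
    (use assms radius_pos[OF assms(2)] rho_nonneg in simp_all)

lemma kernel_nonneg:
  assumes "v \<in> annulus" "t \<in> {s..r}"
  shows "0 \<le> (case p of (m::nat, l) \<Rightarrow> (\<rho> / t) ^ m * (nrm (v l) * t powi l))"
  using annulus_term_nonneg[OF assms] radius_pos[OF assms(2)] rho_nonneg
  by (auto split: prod.split)

lemma mult_powi_le_iff:
  fixes a b t :: real
  assumes "0 < t"
  shows "a * t powi k \<le> b \<longleftrightarrow> a \<le> b * t powi (- k)"
  using assms by (simp add: power_int_minus field_simps)

text \<open>Term \<open>m\<close> is dominated by the kernel at \<open>(m, k - i + int m)\<close>,
  from which \<open>fst\<close> recovers \<open>m\<close>. One radius suffices for convergence, and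
  \<open>s\<close> is always available.\<close>

lemma vanishing_inner:
  assumes v: "v \<in> annulus"
  shows "vanishing (\<lambda>m. nrm (star_inner A \<delta> v k i m))"
proof (rule vanishing_dominated[OF vanishing_kernel[OF v s_in_radii], of fst])
  let ?h = "\<lambda>(m::nat, l). (\<rho> / s) ^ m * (nrm (v l) * s powi l)"
  show "\<exists>p. fst p = m \<and> nrm (star_inner A \<delta> v k i m) \<le> M * s powi (- (k - i)) * ?h p" for m
    using mult_powi_le_iff[OF s_pos, THEN iffD1, OF nrm_inner_le[OF v s_in_radii, of k i m]]
    by (intro exI[of _ "(m, k - i + int m)"]) (simp add: mult_ac)
  show "0 \<le> M * s powi (- (k - i))"
    using M_nonneg s_pos by simp
qed

lemma has_nsum_shift: "v \<in> annulus \<Longrightarrow> has_nsum (star_inner A \<delta> v k i) (shift i v k)"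
  unfolding shift_def by (rule has_norm_sum_vanishing[OF inner_closed vanishing_inner])

lemma shift_closed: "v \<in> annulus \<Longrightarrow> shift i v k \<in> carrier A"
  using has_nsum_shift has_norm_sum_closed by blast

lemma nrm_shift_le:
  assumes v: "v \<in> annulus" and t: "t \<in> {s..r}"
  shows "\<exists>m::nat. nrm (shift i v k) * t powi (k - i) \<le>
    M * ((\<rho> / t) ^ m * (nrm (v (k - i + int m)) * t powi (k - i + int m)))"
proof -
  obtain m where "nrm (shift i v k) \<le> nrm (star_inner A \<delta> v k i m)"
    using nrm_norm_sum_le_term[OF inner_closed[OF v] vanishing_inner[OF v]]
    unfolding shift_def by blast
  then have "nrm (shift i v k) * t powi (k - i) \<le> nrm (star_inner A \<delta> v k i m) * t powi (k - i)"
    using radius_pos[OF t] by (intro mult_right_mono) auto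
  also note nrm_inner_le[OF v t, of k i m]
  finally show ?thesis by blast
qed

lemma shift_in_annulus:
  assumes v: "v \<in> annulus"
  shows "shift i v \<in> annulus"
  unfolding annulus_iff
proof (intro conjI allI ballI)
  show "shift i v k \<in> carrier A" for k
    using v by (rule shift_closed)
  fix t assume t: "t \<in> {s..r}"
  have t0: "0 < t" using t by (rule radius_pos)
  let ?h = "\<lambda>(m::nat, l). (\<rho> / t) ^ m * (nrm (v l) * t powi l)"
  show "vanishing (\<lambda>k. nrm (shift i v k) * t powi k)"
  \<comment> \<open>The index map is \<open>l = k - i + m\<close> solved for
    \<open>k\<close>.\<close>
  proof (rule vanishing_dominated[OF vanishing_kernel[OF v t], of "\<lambda>(m, l). l - int m + i"])
    fix k
    obtain m :: nat where m: "nrm (shift i v k) * t powi (k - i) \<le>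
        M * ((\<rho> / t) ^ m * (nrm (v (k - i + int m)) * t powi (k - i + int m)))"
      using nrm_shift_le[OF v t] by blast
    have "nrm (shift i v k) * t powi k = t powi i * (nrm (shift i v k) * t powi (k - i))"
      using t0 by (simp add: power_int_diff)
    also have "\<dots> \<le> M * t powi i * ?h (m, k - i + int m)"
      using mult_left_mono[OF m, of "t powi i"] t0 by (simp add: mult_ac)
    finally show "\<exists>p. (case p of (m, l) \<Rightarrow> l - int m + i) = k \<and>
        nrm (shift i v k) * t powi k \<le> M * t powi i * ?h p"
      by (intro exI[of _ "(m, k - i + int m)"]) simp
  qed (use M_nonneg t0 in simp)
qed

text \<open>The bound holds for all \<open>i\<close> at a fixed \<open>k\<close>. Its growth
  \<open>s powi i\<close> is exactly what the decay of \<open>nrm (u i) * s powi i\<close> absorbs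
  in the outer sum.\<close>

lemma nrm_shift_bounded:
  assumes v: "v \<in> annulus"
  obtains B where "0 \<le> B" "\<And>i. nrm (shift i v k) \<le> B * s powi i"
proof -
  obtain B where B: "0 < B" "\<And>p. (\<lambda>(m::nat, l). (\<rho> / s) ^ m * (nrm (v l) * s powi l)) p \<le> B"
    using vanishing_bounded[OF vanishing_kernel[OF v s_in_radii]] by blast
  have "nrm (shift i v k) \<le> M * B * s powi (- k) * s powi i" for i
  proof -
    obtain m :: nat where "nrm (shift i v k) * s powi (k - i) \<le>
        M * ((\<rho> / s) ^ m * (nrm (v (k - i + int m)) * s powi (k - i + int m)))"
      using nrm_shift_le[OF v s_in_radii] by blast
    also have "\<dots> \<le> M * B"
      using B(2)[of "(m, k - i + int m)"] M_nonneg by (intro mult_left_mono) auto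
    finally have "nrm (shift i v k) \<le> M * B * s powi (- (k - i))"
      by (rule mult_powi_le_iff[OF s_pos, THEN iffD1])
    also have "\<dots> = M * B * s powi (- k) * s powi i"
      using s_pos by (simp add: power_int_diff power_int_minus divide_inverse)
    finally show ?thesis .
  qed
  then show ?thesis
    using that[of "M * B * s powi (- k)"] B(1) M_nonneg s_pos by simp
qed

text \<open>The free constant \<open>c\<close> covers the terms of the star product and also their
  variants with \<delta> applied to one of the two factors, as they arise from the Leibniz
  rule.\<close>

lemma vanishing_times_shift:
  assumes u: "u \<in> annulus" and v: "v \<in> annulus" and c: "0 \<le> c"
    and le: "\<And>i. g i \<le> c * nrm (u i) * nrm (shift i v k)"
  shows "vanishing g"
proof -
  obtain B where B: "0 \<le> B" "\<And>i. nrm (shift i v k) \<le> B * s powi i"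
    using nrm_shift_bounded[OF v] by blast
  show ?thesis
  proof (rule vanishing_le[OF annulus_vanishing[OF u s_in_radii]])
    show "g i \<le> c * B * (nrm (u i) * s powi i)" for i
    proof -
      have "c * nrm (u i) * nrm (shift i v k) \<le> c * nrm (u i) * (B * s powi i)"
        using c B(2) nrm_nonneg[OF annulus_closed[OF u]] by (intro mult_left_mono) auto
      then show ?thesis
        using le[of i] by (simp add: mult_ac)
    qed
  qed (use c B in simp)
qed

lemma outer_closed: "u \<in> annulus \<Longrightarrow> v \<in> annulus \<Longrightarrow> u i \<otimes> shift i v k \<in> carrier A"
  by (simp add: annulus_closed shift_closed)

lemma vanishing_outer:
  assumes u: "u \<in> annulus" and v: "v \<in> annulus"
  shows "vanishing (\<lambda>i. nrm (u i \<otimes> shift i v k))"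
  by (rule vanishing_times_shift[OF u v C_nonneg nrm_mult])
    (simp_all add: u v annulus_closed shift_closed)

lemma has_nsum_star:
  assumes "u \<in> annulus" "v \<in> annulus"
  shows "has_nsum (\<lambda>i. u i \<otimes> shift i v k) ((u \<star> v) k)"
  unfolding star_mult_shift
  using assms by (intro has_norm_sum_vanishing outer_closed vanishing_outer)

lemma star_convergent: "u \<in> annulus \<Longrightarrow> v \<in> annulus \<Longrightarrow> star_convergent A nrm \<delta> u v"
  unfolding star_convergent_def norm_summable_def star_outer_def[abs_def] shift_def[symmetric]
  using has_nsum_shift has_nsum_star by blast

lemma star_closed: "u \<in> annulus \<Longrightarrow> v \<in> annulus \<Longrightarrow> (u \<star> v) k \<in> carrier A"
  using has_nsum_star has_norm_sum_closed by blast

text \<open>The outer sum is bounded by one term \<open>i\<close>, the inner one by one term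
  \<open>m\<close>, and \<open>t powi k\<close> splits as \<open>t powi i * t powi (k - i)\<close>.
  Both the decay of the coefficients and the boundedness of the product rest on this
  estimate.\<close>

lemma nrm_star_le:
  assumes u: "u \<in> annulus" and v: "v \<in> annulus" and t: "t \<in> {s..r}"
  shows "\<exists>i m. nrm ((u \<star> v) k) * t powi k \<le>
    C * M * ((nrm (u i) * t powi i) * ((\<rho> / t) ^ m * (nrm (v (k - i + int m)) * t powi (k - i + int m))))"
proof -
  have t0: "0 < t" using t by (rule radius_pos)
  obtain i where i: "nrm ((u \<star> v) k) \<le> nrm (u i \<otimes> shift i v k)"
    using nrm_norm_sum_le_term[OF outer_closed[OF u v] vanishing_outer[OF u v]]
    unfolding star_mult_shift by blast
  obtain m :: nat where m: "nrm (shift i v k) * t powi (k - i) \<le>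
      M * ((\<rho> / t) ^ m * (nrm (v (k - i + int m)) * t powi (k - i + int m)))"
    using nrm_shift_le[OF v t] by blast
  note i
  also have "nrm (u i \<otimes> shift i v k) \<le> C * nrm (u i) * nrm (shift i v k)"
    by (rule nrm_mult[OF annulus_closed[OF u] shift_closed[OF v]])
  finally have "nrm ((u \<star> v) k) * t powi k \<le> C * nrm (u i) * nrm (shift i v k) * t powi k"
    using t0 by (intro mult_right_mono) auto
  also have "\<dots> = C * (nrm (u i) * t powi i) * (nrm (shift i v k) * t powi (k - i))"
    using t0 by (simp add: power_int_diff)
  also have "\<dots> \<le> C * (nrm (u i) * t powi i) *
      (M * ((\<rho> / t) ^ m * (nrm (v (k - i + int m)) * t powi (k - i + int m))))"
    using C_nonneg annulus_term_nonneg[OF u t] by (intro mult_left_mono[OF m]) simp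
  finally show ?thesis
    by (auto simp: mult_ac)
qed

text \<open>The common null family behind \<open>star_in_annulus\<close> and the exchange of sums in
  \<open>star_assoc\<close>.\<close>

lemma vanishing_triple:
  assumes "u \<in> annulus" "v \<in> annulus" "t \<in> {s..r}"
  shows "vanishing (\<lambda>(i, p). (nrm (u i) * t powi i) *
    (case p of (m::nat, l) \<Rightarrow> (\<rho> / t) ^ m * (nrm (v l) * t powi l)))"
  by (rule vanishing_prod[OF annulus_vanishing annulus_term_nonneg vanishing_kernel kernel_nonneg])
    (use assms in auto)

lemma star_in_annulus:
  assumes u: "u \<in> annulus" and v: "v \<in> annulus"
  shows "u \<star> v \<in> annulus"
  unfolding annulus_iff
proof (intro conjI allI ballI)
  show "(u \<star> v) k \<in> carrier A" for k
    using u v by (rule star_closed)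
  fix t assume t: "t \<in> {s..r}"
  let ?h = "\<lambda>(i, p). (nrm (u i) * t powi i) *
    (case p of (m::nat, l) \<Rightarrow> (\<rho> / t) ^ m * (nrm (v l) * t powi l))"
  show "vanishing (\<lambda>k. nrm ((u \<star> v) k) * t powi k)"
  proof (rule vanishing_dominated[OF vanishing_triple[OF u v t], of "\<lambda>(i, m, l). l - int m + i"])
    fix k
    obtain i m where "nrm ((u \<star> v) k) * t powi k \<le> C * M * ?h (i, m, k - i + int m)"
      unfolding prod.case using nrm_star_le[OF u v t] by blast
    then show "\<exists>p. (case p of (i, m, l) \<Rightarrow> l - int m + i) = k \<and>
        nrm ((u \<star> v) k) * t powi k \<le> C * M * ?h p"
      by (intro exI[of _ "(i, m, k - i + int m)"]) simp
  qed (use C_nonneg M_nonneg in simp)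
qed

section \<open>Integer powers of left multiplication by \<partial>, and associativity\<close>

lemma shift_0:
  assumes v: "v \<in> annulus"
  shows "shift 0 v = v"
proof
  fix k
  have "has_nsum (star_inner A \<delta> v k 0) (star_inner A \<delta> v k 0 0)"
  proof (rule has_norm_sum_single)
    fix m :: nat assume "m \<noteq> 0"
    then show "star_inner A \<delta> v k 0 m = \<zero>"
      by (cases m) (simp_all add: star_inner_def int_binom_0_Suc add_pow_int_ge)
  qed (rule inner_closed[OF v])
  moreover have "star_inner A \<delta> v k 0 0 = v k"
    using annulus_closed[OF v] by (simp add: star_inner_def int_binom_0_right)
  ultimately show "shift 0 v k = v k"
    unfolding shift_def using norm_sum_eqI by simp
qed

text \<open>Pascal's rule under the summation sign: one summand of the binomial coefficient gives
  the series for \<open>i\<close> at \<open>k - 1\<close>, the other gives \<delta> of the series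
  for \<open>i\<close> at \<open>k\<close>, moved by one place in \<open>m\<close>.\<close>

lemma shift_add_1:
  assumes v: "v \<in> annulus"
  shows "shift (i + 1) v k = shift i v (k - 1) \<oplus> \<delta> (shift i v k)"
proof -
  let ?f = "star_inner A \<delta> v (k - 1) i" and ?g = "\<lambda>m. \<delta> (star_inner A \<delta> v k i m)"
  \<comment> \<open>The zero in front makes term \<open>m\<close> of the first series meet term
    \<open>m - 1\<close> of the second.\<close>
  let ?g' = "case_nat \<zero> ?g"
  note ic = inner_closed[OF v]
  have gc: "?g' m \<in> carrier A" for m
    using ic delta_closed by (cases m) auto
  have "has_nsum ?g (\<delta> (shift i v k))"
    by (rule has_norm_sum_map[OF delta_closed delta_add has_nsum_shift[OF v] ic nrm_delta])
  then have "has_nsum ?g' (\<delta> (shift i v k))"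
  proof (intro has_norm_sum_extend_zero[of ?g' Suc])
    show "?g' m = \<zero>" if "m \<notin> range Suc" for m
      using that by (cases m) auto
  qed (use gc in simp_all)
  then have "has_nsum (\<lambda>m. ?f m \<oplus> ?g' m) (shift i v (k - 1) \<oplus> \<delta> (shift i v k))"
    by (rule has_norm_sum_add[OF has_nsum_shift[OF v] _ ic gc])
  moreover have "?f m \<oplus> ?g' m = star_inner A \<delta> v k (i + 1) m" for m
  proof (cases m)
    case 0
    then show ?thesis
      using annulus_closed[OF v]
      by (simp add: star_inner_def int_binom_0_right diff_diff_eq add.commute)
  next
    case (Suc n)
    have ix: "k - 1 - i + int (Suc n) = k - i + int n" "k - (i + 1) + int (Suc n) = k - i + int n"
      by auto
    let ?x = "v (k - i + int n)"
    have "?g n = [int_binom i n] \<cdot>\<^bsub>A\<^esub> (\<delta> ^^ Suc n) ?x"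
      unfolding star_inner_def using delta_pow_closed[OF annulus_closed[OF v]]
      by (simp add: delta_int_mult)
    then show ?thesis
      unfolding Suc star_inner_def ix
      using delta_pow_closed[OF annulus_closed[OF v], of "Suc n"]
      by (simp add: int_binom_Suc_Suc add.int_pow_mult star_inner_def)
  qed
  ultimately have "has_nsum (star_inner A \<delta> v k (i + 1)) (shift i v (k - 1) \<oplus> \<delta> (shift i v k))"
    by simp
  then show ?thesis
    unfolding shift_def[of "i + 1"] by (rule norm_sum_eqI)
qed

lemma shift_1: "v \<in> annulus \<Longrightarrow> shift 1 v k = v (k - 1) \<oplus> \<delta> (v k)"
  using shift_add_1[of v 0 k] by (simp add: shift_0)

lemma shift_1_shift: "v \<in> annulus \<Longrightarrow> shift 1 (shift i v) = shift (i + 1) v"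
  by (rule ext) (simp add: shift_1 shift_in_annulus shift_add_1)

text \<open>The group law with the factor 1 on the other side. For \<open>i = -1\<close> the
  identity \<open>shift_1_shift\<close> provides a right inverse of \<open>shift 1\<close>; this one
  provides the left inverse, hence injectivity. The comparison is termwise, since \<delta> commutes
  with its powers and with integer multiples.\<close>

lemma shift_shift_1:
  assumes v: "v \<in> annulus"
  shows "shift i (shift 1 v) = shift (i + 1) v"
proof
  fix k
  note ic = inner_closed[OF v]
  have "has_nsum (\<lambda>m. star_inner A \<delta> v (k - 1) i m \<oplus> \<delta> (star_inner A \<delta> v k i m))
      (shift i v (k - 1) \<oplus> \<delta> (shift i v k))"
    by (intro has_norm_sum_add has_norm_sum_map[OF delta_closed delta_add _ _ nrm_delta]
        has_nsum_shift v ic delta_closed)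
  moreover have "star_inner A \<delta> v (k - 1) i m \<oplus> \<delta> (star_inner A \<delta> v k i m) =
      star_inner A \<delta> (shift 1 v) k i m" for m
  proof -
    let ?l = "k - i + int m"
    have ix: "k - 1 - i + int m = ?l - 1" by simp
    have vc: "v j \<in> carrier A" for j using v by (rule annulus_closed)
    have "\<delta> (star_inner A \<delta> v k i m) = [int_binom i m] \<cdot>\<^bsub>A\<^esub> (\<delta> ^^ m) (\<delta> (v ?l))"
      unfolding star_inner_def using delta_pow_closed[OF vc]
      by (simp add: delta_int_mult funpow_swap1)
    then show ?thesis
      unfolding star_inner_def ix using vc
      by (simp add: shift_1[OF v] delta_pow_add delta_closed delta_pow_closed add.int_pow_distrib)
  qed
  ultimately have "has_nsum (star_inner A \<delta> (shift 1 v) k i) (shift i v (k - 1) \<oplus> \<delta> (shift i v k))"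
    by simp
  then show "shift i (shift 1 v) k = shift (i + 1) v k"
    unfolding shift_def[of i "shift 1 v"] shift_add_1[OF v] by (rule norm_sum_eqI)
qed

lemma shift_1_inj:
  assumes "v \<in> annulus" "w \<in> annulus" "shift 1 v = shift 1 w"
  shows "v = w"
proof -
  have "shift (-1) (shift 1 x) = x" if "x \<in> annulus" for x
    using shift_shift_1[OF that, of "-1"] shift_0[OF that] by simp
  then show ?thesis
    using assms by metis
qed

text \<open>Coefficient \<open>i\<close> of \<open>shift 1 v\<close> is
  \<open>v (i - 1) \<oplus> \<delta> (v i)\<close>. In the sum for \<open>v (i - 1)\<close>, moving
  the index by one lets \<open>shift_add_1\<close> expand the other factor; in the sum for
  \<open>\<delta> (v i)\<close>, the Leibniz rule supplies the missing half of \<delta> of the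
  product.\<close>

lemma star_shift_1:
  assumes v: "v \<in> annulus" and w: "w \<in> annulus"
  shows "shift 1 v \<star> w = shift 1 (v \<star> w)"
proof
  fix k
  have vc: "v i \<in> carrier A" and wc: "shift i w l \<in> carrier A" for i l
    using v w annulus_closed shift_closed by auto
  note closed = vc wc delta_closed
  \<comment> \<open>The sum of \<open>?d\<close> equals the sum of \<open>?a\<close> plus that of
    \<open>?b\<close> after moving the index, and \<open>?c\<close> plus \<open>?b\<close> sum to
    \<open>\<delta> ((v \<star> w) k)\<close>. The left side of the claim sums \<open>?d\<close>
    plus \<open>?c\<close>.\<close>
  let ?a = "\<lambda>i. v i \<otimes> shift i w (k - 1)" and ?b = "\<lambda>i. v i \<otimes> \<delta> (shift i w k)"
  let ?c = "\<lambda>i. \<delta> (v i) \<otimes> shift i w k" and ?d = "\<lambda>i. v (i - 1) \<otimes> shift i w k"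
  have Mrho: "0 \<le> C * (M * \<rho>)"
    using C_nonneg M_nonneg rho_nonneg by simp
  have b: "has_nsum ?b (nsum ?b)"
  proof (intro has_norm_sum_vanishing vanishing_times_shift[OF v w Mrho])
    fix i
    have "nrm (?b i) \<le> C * nrm (v i) * nrm (\<delta> (shift i w k))"
      by (intro nrm_mult closed)
    also have "\<dots> \<le> C * nrm (v i) * (M * \<rho> * nrm (shift i w k))"
      using C_nonneg nrm_nonneg[OF vc] by (intro mult_left_mono nrm_delta closed) simp
    finally show "nrm (?b i) \<le> C * (M * \<rho>) * nrm (v i) * nrm (shift i w k)"
      by (simp add: mult_ac)
  qed (simp add: closed)
  have c: "has_nsum ?c (nsum ?c)"
  proof (intro has_norm_sum_vanishing vanishing_times_shift[OF v w Mrho])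
    fix i
    have "nrm (?c i) \<le> C * nrm (\<delta> (v i)) * nrm (shift i w k)"
      by (intro nrm_mult closed)
    also have "\<dots> \<le> C * (M * \<rho> * nrm (v i)) * nrm (shift i w k)"
      using C_nonneg nrm_nonneg[OF wc] by (intro mult_left_mono mult_right_mono nrm_delta closed) simp_all
    finally show "nrm (?c i) \<le> C * (M * \<rho>) * nrm (v i) * nrm (shift i w k)"
      by (simp add: mult_ac)
  qed (simp add: closed)
  have "has_nsum (\<lambda>i. \<delta> (v i \<otimes> shift i w k)) (\<delta> ((v \<star> w) k))"
    by (rule has_norm_sum_map[OF delta_closed delta_add has_nsum_star[OF v w] _ nrm_delta])
      (simp_all add: closed)
  moreover have "has_nsum (\<lambda>i. ?c i \<oplus> ?b i) (nsum ?c \<oplus> nsum ?b)"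
    using b c by (intro has_norm_sum_add) (simp_all add: closed)
  ultimately have d: "\<delta> ((v \<star> w) k) = nsum ?c \<oplus> nsum ?b"
    using delta_mult closed has_norm_sum_unique by simp
  have "has_nsum (\<lambda>i. ?a i \<oplus> ?b i) ((v \<star> w) (k - 1) \<oplus> nsum ?b)"
    using has_nsum_star[OF v w] b by (intro has_norm_sum_add) (simp_all add: closed)
  then have "has_nsum (\<lambda>i. ?d (i + 1)) ((v \<star> w) (k - 1) \<oplus> nsum ?b)"
    by (simp add: shift_add_1 w r_distr closed)
  then have "has_nsum ?d ((v \<star> w) (k - 1) \<oplus> nsum ?b)"
  proof (rule has_norm_sum_extend_zero)
    show "?d i = \<zero>" if "i \<notin> range (\<lambda>i. i + 1)" for i
      using that rangeI[of "\<lambda>i. i + 1" "i - 1"] by simp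
  qed (simp_all add: closed inj_def)
  then have "has_nsum (\<lambda>i. ?d i \<oplus> ?c i) ((v \<star> w) (k - 1) \<oplus> nsum ?b \<oplus> nsum ?c)"
    using c by (intro has_norm_sum_add) (simp_all add: closed)
  moreover have "?d i \<oplus> ?c i = shift 1 v i \<otimes> shift i w k" for i
    by (simp add: shift_1 v l_distr closed)
  ultimately have "(shift 1 v \<star> w) k = (v \<star> w) (k - 1) \<oplus> nsum ?b \<oplus> nsum ?c"
    unfolding star_mult_shift[of "shift 1 v"] by (intro norm_sum_eqI) simp
  also have "\<dots> = (v \<star> w) (k - 1) \<oplus> \<delta> ((v \<star> w) k)"
    unfolding d using star_closed[OF v w] has_norm_sum_closed[OF b] has_norm_sum_closed[OF c]
    by (simp add: a_ac)
  also have "\<dots> = shift 1 (v \<star> w) k"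
    by (simp add: shift_1 star_in_annulus v w)
  finally show "(shift 1 v \<star> w) k = shift 1 (v \<star> w) k" .
qed

text \<open>The upward step applies \<open>star_shift_1\<close>. For the downward step both sides
  agree after applying \<open>shift 1\<close>, which is injective.\<close>

lemma star_shift:
  assumes v: "v \<in> annulus" and w: "w \<in> annulus"
  shows "shift i v \<star> w = shift i (v \<star> w)"
proof (induction i rule: int_induct[where k = 0])
  case base
  then show ?case by (simp add: shift_0 star_in_annulus v w)
next
  case (step1 i)
  have "shift (i + 1) v \<star> w = shift 1 (shift i v \<star> w)"
    by (simp add: shift_1_shift[symmetric] star_shift_1 shift_in_annulus v w)
  also have "\<dots> = shift (i + 1) (v \<star> w)"
    by (simp add: step1 shift_1_shift star_in_annulus v w)
  finally show ?case .
next
  case (step2 i)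
  have "shift 1 (shift (i - 1) v \<star> w) = shift i v \<star> w"
    using shift_1_shift[OF v, of "i - 1"] star_shift_1[OF shift_in_annulus[OF v] w, of "i - 1"] by simp
  also have "\<dots> = shift 1 (shift (i - 1) (v \<star> w))"
    using step2 shift_1_shift[OF star_in_annulus[OF v w], of "i - 1"] by simp
  finally show ?case
    by (rule shift_1_inj[rotated 2]) (intro star_in_annulus shift_in_annulus v w)+
qed

text \<open>Coefficient \<open>k\<close> of either side is an iterated sum of \<open>?f i j\<close>.
  Summing over \<open>i\<close> first produces \<open>(u \<star> v) j\<close>; summing over
  \<open>j\<close> first produces \<open>shift i v \<star> w\<close>, which
  \<open>star_shift\<close> rewrites as \<open>shift i (v \<star> w)\<close>.\<close>

lemma star_assoc:
  assumes u: "u \<in> annulus" and v: "v \<in> annulus" and w: "w \<in> annulus"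
  shows "u \<star> v \<star> w = u \<star> (v \<star> w)"
proof
  fix k
  have uc: "u i \<in> carrier A" and vc: "shift i v l \<in> carrier A" and wc: "shift i w l \<in> carrier A" for i l
    using u v w annulus_closed shift_closed by auto
  let ?f = "\<lambda>i j. u i \<otimes> shift i v j \<otimes> shift j w k"
  have fc: "?f i j \<in> carrier A" for i j
    by (simp add: uc vc wc)
  obtain B where B: "0 \<le> B" "\<And>j. nrm (shift j w k) \<le> B * s powi j"
    using nrm_shift_bounded[OF w] by blast
  let ?h = "\<lambda>(i, p). (nrm (u i) * s powi i) *
    (case p of (m::nat, l) \<Rightarrow> (\<rho> / s) ^ m * (nrm (v l) * s powi l))"
  have "vanishing (\<lambda>(i, j). nrm (?f i j))"
  \<comment> \<open>The map retains \<open>i\<close> and recovers the middle index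
    \<open>j = l - m + i\<close>. The bound \<open>B * s powi j\<close> on
    \<open>shift j w k\<close> supplies the weight that splits as
    \<open>s powi i * s powi (j - i)\<close>.\<close>
  proof (rule vanishing_dominated[OF vanishing_triple[OF u v s_in_radii], of "\<lambda>(i, m, l). (i, l - int m + i)"])
    fix q :: "int \<times> int"
    obtain i j where q: "q = (i, j)" by (cases q)
    obtain m :: nat where m: "nrm (shift i v j) * s powi (j - i) \<le>
        M * ((\<rho> / s) ^ m * (nrm (v (j - i + int m)) * s powi (j - i + int m)))"
      using nrm_shift_le[OF v s_in_radii] by blast
    have "nrm (?f i j) \<le> C * nrm (u i \<otimes> shift i v j) * nrm (shift j w k)"
      by (intro nrm_mult) (simp_all add: uc vc wc)
    also have "\<dots> \<le> C * (C * nrm (u i) * nrm (shift i v j)) * (B * s powi j)"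
      using C_nonneg nrm_nonneg uc vc wc B
      by (intro mult_mono mult_left_mono nrm_mult) (auto intro!: mult_nonneg_nonneg)
    also have "\<dots> = C * C * B * (nrm (u i) * s powi i) * (nrm (shift i v j) * s powi (j - i))"
      using s_pos by (simp add: power_int_diff)
    also have "\<dots> \<le> C * C * B * (nrm (u i) * s powi i) *
        (M * ((\<rho> / s) ^ m * (nrm (v (j - i + int m)) * s powi (j - i + int m))))"
      using C_nonneg B(1) annulus_term_nonneg[OF u s_in_radii] by (intro mult_left_mono[OF m]) simp
    also have "\<dots> = C * C * B * M * ?h (i, m, j - i + int m)"
      by simp
    finally show "\<exists>p. (case p of (i, m, l) \<Rightarrow> (i, l - int m + i)) = q \<and>
        (case q of (i, j) \<Rightarrow> nrm (?f i j)) \<le> C * C * B * M * ?h p"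
      by (intro exI[of _ "(i, m, j - i + int m)"]) (simp add: q)
  qed (use C_nonneg B(1) M_nonneg in simp)
  note swap = norm_sum_swap[of ?f, OF fc this]
  have "nsum (\<lambda>i. ?f i j) = (u \<star> v) j \<otimes> shift j w k" for j
  proof (intro norm_sum_eqI has_norm_sum_map[of "\<lambda>x. x \<otimes> shift j w k", OF _ _ has_nsum_star[OF u v]])
    show "nrm (x \<otimes> shift j w k) \<le> C * nrm (shift j w k) * nrm x" if "x \<in> carrier A" for x
      using nrm_mult[OF that wc] by (simp add: mult_ac)
  qed (simp_all add: uc vc wc l_distr)
  then have "(u \<star> v \<star> w) k = nsum (\<lambda>j. nsum (\<lambda>i. ?f i j))"
    by (simp add: star_mult_shift[of "u \<star> v"])
  also have "\<dots> = nsum (\<lambda>i. nsum (?f i))"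
    using swap by simp
  also have "nsum (?f i) = u i \<otimes> shift i (v \<star> w) k" for i
  proof -
    have "has_nsum (\<lambda>j. u i \<otimes> (shift i v j \<otimes> shift j w k)) (u i \<otimes> (shift i v \<star> w) k)"
    proof (rule has_norm_sum_map[OF _ _ has_nsum_star[OF shift_in_annulus[OF v] w]])
      show "nrm (u i \<otimes> x) \<le> C * nrm (u i) * nrm x" if "x \<in> carrier A" for x
        using uc that by (rule nrm_mult)
    qed (simp_all add: uc vc wc r_distr)
    then show ?thesis
      using norm_sum_eqI by (simp add: star_shift v w m_assoc uc vc wc)
  qed
  then have "nsum (\<lambda>i. nsum (?f i)) = (u \<star> (v \<star> w)) k"
    by (simp add: star_mult_shift[of u "v \<star> w"])
  finally show "(u \<star> v \<star> w) k = (u \<star> (v \<star> w)) k" .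
qed

section \<open>The unit and distributivity\<close>

abbreviation one_fun :: "int \<Rightarrow> 'a" ("\<one>\<^sub>a") where
  "\<one>\<^sub>a \<equiv> (\<lambda>j. if j = 0 then \<one> else \<zero>)"

lemma one_in_annulus: "\<one>\<^sub>a \<in> annulus"
  unfolding annulus_iff
proof (intro conjI allI ballI)
  fix t
  have "{i. e \<le> nrm (\<one>\<^sub>a i) * t powi i} \<subseteq> {0}" if "0 < e" for e
    using that by (auto simp: nrm_zero)
  then show "vanishing (\<lambda>j. nrm (\<one>\<^sub>a j) * t powi j)"
    unfolding vanishing_def using finite_subset by blast
qed simp

lemma one_star:
  assumes v: "v \<in> annulus"
  shows "\<one>\<^sub>a \<star> v = v"
proof
  fix k
  have "has_nsum (\<lambda>i. \<one>\<^sub>a i \<otimes> shift i v k) (\<one>\<^sub>a 0 \<otimes> shift 0 v k)"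
    by (rule has_norm_sum_single) (simp_all add: shift_closed v)
  then show "(\<one>\<^sub>a \<star> v) k = v k"
    using norm_sum_eqI by (simp add: star_mult_shift shift_0 v annulus_closed)
qed

text \<open>By the Leibniz rule \<delta> annihilates 1, so only the term \<open>m = 0\<close> of the
  binomial series survives.\<close>

lemma shift_one: "shift i \<one>\<^sub>a k = (if k = i then \<one> else \<zero>)"
proof -
  have "has_nsum (star_inner A \<delta> \<one>\<^sub>a k i) (star_inner A \<delta> \<one>\<^sub>a k i 0)"
  proof (rule has_norm_sum_single)
    fix m :: nat assume "m \<noteq> 0"
    then obtain n where m: "m = Suc n" by (cases m) auto
    have "(\<delta> ^^ m) \<one> = \<zero>"
      unfolding m funpow_Suc_right by (simp add: delta_one delta_pow_zero)
    then have "(\<delta> ^^ m) (\<one>\<^sub>a l) = \<zero>" for l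
      by (simp add: delta_pow_zero)
    then show "star_inner A \<delta> \<one>\<^sub>a k i m = \<zero>"
      by (simp add: star_inner_def)
  qed (rule inner_closed[OF one_in_annulus])
  moreover have "star_inner A \<delta> \<one>\<^sub>a k i 0 = (if k = i then \<one> else \<zero>)"
    by (simp add: star_inner_def int_binom_0_right)
  ultimately show ?thesis
    unfolding shift_def by (simp only: norm_sum_eqI)
qed

lemma star_one:
  assumes u: "u \<in> annulus"
  shows "u \<star> \<one>\<^sub>a = u"
proof
  fix k
  have "has_nsum (\<lambda>i. u i \<otimes> shift i \<one>\<^sub>a k) (u k \<otimes> shift k \<one>\<^sub>a k)"
    by (rule has_norm_sum_single) (simp_all add: shift_one annulus_closed u)
  then show "(u \<star> \<one>\<^sub>a) k = u k"
    using norm_sum_eqI by (simp add: star_mult_shift shift_one u annulus_closed)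
qed

lemma annulus_add:
  assumes u: "u \<in> annulus" and v: "v \<in> annulus"
  shows "(\<lambda>j. u j \<oplus> v j) \<in> annulus"
  unfolding annulus_iff
proof (intro conjI allI ballI)
  show "u j \<oplus> v j \<in> carrier A" for j
    by (simp add: u v annulus_closed)
  fix t assume t: "t \<in> {s..r}"
  show "vanishing (\<lambda>j. nrm (u j \<oplus> v j) * t powi j)"
    unfolding vanishing_def
  proof (intro allI impI)
    fix e :: real assume e: "0 < e"
    have "{j. e \<le> nrm (u j \<oplus> v j) * t powi j} \<subseteq>
        {j. e \<le> nrm (u j) * t powi j} \<union> {j. e \<le> nrm (v j) * t powi j}"
    proof
      fix j assume "j \<in> {j. e \<le> nrm (u j \<oplus> v j) * t powi j}"
      then have "e \<le> nrm (u j \<oplus> v j) * t powi j" ..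
      also have "nrm (u j \<oplus> v j) * t powi j \<le> max (nrm (u j)) (nrm (v j)) * t powi j"
        using radius_pos[OF t] annulus_closed u v by (intro mult_right_mono nrm_add) auto
      finally show "j \<in> {j. e \<le> nrm (u j) * t powi j} \<union> {j. e \<le> nrm (v j) * t powi j}"
        by (auto simp: max_def split: if_splits)
    qed
    then show "finite {j. e \<le> nrm (u j \<oplus> v j) * t powi j}"
      using vanishingD[OF annulus_vanishing[OF u t] e] vanishingD[OF annulus_vanishing[OF v t] e]
        finite_subset by blast
  qed
qed

lemma star_l_distr:
  assumes u: "u \<in> annulus" and v: "v \<in> annulus" and w: "w \<in> annulus"
  shows "(\<lambda>j. u j \<oplus> v j) \<star> w = (\<lambda>j. (u \<star> w) j \<oplus> (v \<star> w) j)"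
proof
  fix k
  have "has_nsum (\<lambda>i. u i \<otimes> shift i w k \<oplus> v i \<otimes> shift i w k) ((u \<star> w) k \<oplus> (v \<star> w) k)"
    by (intro has_norm_sum_add has_nsum_star outer_closed u v w)
  then show "((\<lambda>j. u j \<oplus> v j) \<star> w) k = (u \<star> w) k \<oplus> (v \<star> w) k"
    using norm_sum_eqI by (simp add: star_mult_shift l_distr annulus_closed shift_closed u v w)
qed

lemma shift_add:
  assumes v: "v \<in> annulus" and w: "w \<in> annulus"
  shows "shift i (\<lambda>j. v j \<oplus> w j) k = shift i v k \<oplus> shift i w k"
proof -
  have "has_nsum (\<lambda>m. star_inner A \<delta> v k i m \<oplus> star_inner A \<delta> w k i m) (shift i v k \<oplus> shift i w k)"
    by (intro has_norm_sum_add has_nsum_shift inner_closed v w)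
  moreover have "star_inner A \<delta> v k i m \<oplus> star_inner A \<delta> w k i m =
      star_inner A \<delta> (\<lambda>j. v j \<oplus> w j) k i m" for m
    by (simp add: star_inner_def delta_pow_add delta_pow_closed annulus_closed v w add.int_pow_distrib)
  ultimately have "has_nsum (star_inner A \<delta> (\<lambda>j. v j \<oplus> w j) k i) (shift i v k \<oplus> shift i w k)"
    by simp
  then show ?thesis
    unfolding shift_def[of i "\<lambda>j. v j \<oplus> w j"] by (rule norm_sum_eqI)
qed

lemma star_r_distr:
  assumes u: "u \<in> annulus" and v: "v \<in> annulus" and w: "w \<in> annulus"
  shows "u \<star> (\<lambda>j. v j \<oplus> w j) = (\<lambda>j. (u \<star> v) j \<oplus> (u \<star> w) j)"
proof
  fix k
  have "has_nsum (\<lambda>i. u i \<otimes> shift i v k \<oplus> u i \<otimes> shift i w k) ((u \<star> v) k \<oplus> (u \<star> w) k)"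
    by (intro has_norm_sum_add has_nsum_star outer_closed u v w)
  then show "(u \<star> (\<lambda>j. v j \<oplus> w j)) k = (u \<star> v) k \<oplus> (u \<star> w) k"
    using norm_sum_eqI
    by (simp add: star_mult_shift shift_add r_distr annulus_closed shift_closed u v w)
qed

end


section \<open>Power bounds from the spectral radius\<close>

text \<open>Fekete's lemma.\<close>

lemma submultiplicative_root_convergent:
  fixes a :: "nat \<Rightarrow> real"
  assumes nonneg: "\<And>n. 0 \<le> a n" and sub: "\<And>m n. a (m + n) \<le> a m * a n"
  shows "convergent (\<lambda>n. root n (a n))"
proof -
  \<comment> \<open>Index 0 is excluded because \<open>root 0\<close> is constantly 0 and would
    force the infimum to be 0.\<close>
  define L where "L = (INF n\<in>{1..}. root n (a n))"
  have bdd: "bdd_below ((\<lambda>n. root n (a n)) ` {1..})"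
    using nonneg by (intro bdd_belowI[of _ 0]) auto
  have L_le: "L \<le> root n (a n)" if "1 \<le> n" for n
    unfolding L_def using bdd that by (intro cINF_lower) auto
  have L_nonneg: "0 \<le> L"
    unfolding L_def using nonneg by (intro cINF_greatest) auto
  have upper: "eventually (\<lambda>n. root n (a n) < L + 2 * e) sequentially" if e: "0 < e" for e
  proof -
    \<comment> \<open>Half of the margin \<open>2 * e\<close> is used to find an index
      \<open>k\<close> with root below \<open>q\<close>, the other half to absorb
      \<open>root n B\<close>, which tends to 1.\<close>
    define q where "q = L + e"
    have q: "0 < q" "L < q" using L_nonneg e by (auto simp: q_def)
    obtain k where k: "1 \<le> k" "root k (a k) < q"
      using q(2) bdd unfolding L_def by (subst (asm) cINF_less_iff) auto
    have ak: "a k \<le> q ^ k"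
    proof -
      have "a k = root k (a k) ^ k"
        using k(1) nonneg by simp
      also have "\<dots> \<le> q ^ k"
        using k(2) real_root_ge_zero[OF nonneg] by (intro power_mono) auto
      finally show ?thesis .
    qed
    \<comment> \<open>\<open>B\<close> covers the finitely many remainders below \<open>k\<close> in
      the division of \<open>n\<close> by \<open>k\<close>; the summand 1 makes it positive.\<close>
    define B where "B = 1 + (\<Sum>i<k. a i / q ^ i)"
    have B: "0 < B"
      unfolding B_def using nonneg q(1) by (intro add_pos_nonneg sum_nonneg) auto
    have a_less: "a i \<le> B * q ^ i" if "i < k" for i
    proof -
      have "a i / q ^ i \<le> (\<Sum>i<k. a i / q ^ i)"
        using nonneg q(1) that by (intro member_le_sum) auto
      then have "a i / q ^ i \<le> B" by (simp add: B_def)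
      then show ?thesis using q(1) by (simp add: divide_le_eq)
    qed
    have a_mult: "a (k * j + i) \<le> (q ^ k) ^ j * a i" for i j
    proof (induction j)
      case (Suc j)
      have "a (k * Suc j + i) \<le> a k * a (k * j + i)"
        using sub[of k "k * j + i"] by (simp add: add.assoc)
      also have "\<dots> \<le> q ^ k * ((q ^ k) ^ j * a i)"
        using ak Suc nonneg q(1) by (intro mult_mono) auto
      finally show ?case by (simp add: mult_ac)
    qed simp
    have bound: "a n \<le> B * q ^ n" for n
    proof -
      have "a n \<le> (q ^ k) ^ (n div k) * a (n mod k)"
        using a_mult[of "n div k" "n mod k"] by simp
      also have "\<dots> \<le> (q ^ k) ^ (n div k) * (B * q ^ (n mod k))"
        using q(1) k(1) by (intro mult_left_mono a_less) auto
      also have "\<dots> = B * q ^ (k * (n div k) + n mod k)"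
        unfolding power_add power_mult by (rule mult.left_commute)
      finally show ?thesis by simp
    qed
    have root_le: "root n (a n) \<le> root n B * q" if "1 \<le> n" for n
    proof -
      have "root n (a n) \<le> root n (B * q ^ n)"
        using that bound by (intro real_root_le_mono) auto
      also have "\<dots> = root n B * q"
        using that q(1) by (simp add: real_root_mult real_root_power_cancel)
      finally show ?thesis .
    qed
    have "(\<lambda>n. root n B * q) \<longlonglongrightarrow> 1 * q"
      by (intro tendsto_mult LIMSEQ_root_const B tendsto_const)
    then have "eventually (\<lambda>n. root n B * q < L + 2 * e) sequentially"
      using e by (intro order_tendstoD(2)[of _ "1 * q"]) (auto simp: q_def)
    then show ?thesis
      using eventually_ge_at_top[of 1] by eventually_elim (use root_le order_le_less_trans in blast)
  qed
  have "(\<lambda>n. root n (a n)) \<longlonglongrightarrow> L"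
  proof (rule tendstoI)
    fix e :: real assume "0 < e"
    then have "eventually (\<lambda>n. root n (a n) < L + 2 * (e / 2)) sequentially"
      by (intro upper) simp
    then show "eventually (\<lambda>n. dist (root n (a n)) L < e) sequentially"
      using eventually_ge_at_top[of 1]
    proof eventually_elim
      case (elim n)
      then show ?case
        using L_le[of n] by (simp add: dist_real_def)
    qed
  qed
  then show ?thesis
    by (rule convergentI)
qed

context nonarch_normed_group
begin

text \<open>Fekete's lemma guarantees that \<open>lim\<close> in \<open>spectral_radius\<close>
  denotes an actual limit. Then almost all powers satisfy the bound with factor 1, and
  \<open>M\<close> absorbs the remaining ones.\<close>

lemma spectral_radius_power_bound:
  assumes T: "\<And>x. x \<in> carrier G \<Longrightarrow> T x \<in> carrier G"
    and bdd: "bounded_operator G nrm T"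
    and spec: "spectral_radius G nrm T < s" and "0 < s"
  obtains M \<rho> where "0 \<le> M" "0 \<le> \<rho>" "\<rho> < s"
    "\<And>m x. x \<in> carrier G \<Longrightarrow> nrm ((T ^^ m) x) \<le> M * \<rho> ^ m * nrm x"
proof -
  obtain C where C: "\<And>x. x \<in> carrier G \<Longrightarrow> nrm (T x) \<le> C * nrm x"
    using bdd unfolding bounded_operator_def by blast
  have Tm: "(T ^^ m) x \<in> carrier G" if "x \<in> carrier G" for m x
    using that by (induction m) (auto intro: T)
  \<comment> \<open>This crude bound makes the suprema in \<open>op_norm\<close> range over sets
    bounded above.\<close>
  have Cm: "nrm ((T ^^ m) x) \<le> \<bar>C\<bar> ^ m * nrm x" if x: "x \<in> carrier G" for m x
  proof (induction m)
    case (Suc m)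
    have "nrm ((T ^^ Suc m) x) \<le> C * nrm ((T ^^ m) x)"
      using C[OF Tm[OF x]] by simp
    also have "\<dots> \<le> \<bar>C\<bar> * nrm ((T ^^ m) x)"
      using nrm_nonneg[OF Tm[OF x]] by (intro mult_right_mono) auto
    also have "\<dots> \<le> \<bar>C\<bar> * (\<bar>C\<bar> ^ m * nrm x)"
      using Suc by (intro mult_left_mono) auto
    finally show ?case by simp
  qed simp
  define a where "a m = op_norm G nrm (T ^^ m)" for m
  have quot_le: "nrm ((T ^^ m) x) / nrm x \<le> \<bar>C\<bar> ^ m" if x: "x \<in> carrier G" for m x
    using Cm[OF x] nrm_nonneg[OF x] by (cases "nrm x = 0") (simp_all add: divide_le_eq)
  have bd: "bdd_above ((\<lambda>x. nrm ((T ^^ m) x) / nrm x) ` carrier G)" for m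
    using quot_le by (intro bdd_aboveI[of _ "\<bar>C\<bar> ^ m"]) auto
  have ne: "carrier G \<noteq> {}" using zero_closed by blast
  have a_upper: "nrm ((T ^^ m) x) / nrm x \<le> a m" if "x \<in> carrier G" for m x
    unfolding a_def op_norm_def using bd that by (intro cSUP_upper)
  have a_nonneg: "0 \<le> a m" for m
    using a_upper[of \<zero> m] nrm_zero by simp
  have a_bound: "nrm ((T ^^ m) x) \<le> a m * nrm x" if x: "x \<in> carrier G" for m x
  proof (cases "nrm x = 0")
    \<comment> \<open>Here the quotient is the conventional 0/0 = 0 and carries no information, but
      the crude bound forces the left side to be 0.\<close>
    case True
    then show ?thesis using Cm[OF x, of m] by simp
  next
    case False
    then have "0 < nrm x" using nrm_nonneg[OF x] by simp
    then show ?thesis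
      using a_upper[OF x, of m] by (simp add: divide_le_eq)
  qed
  have a_sub: "a (m + n) \<le> a m * a n" for m n
    unfolding a_def[of "m + n"] op_norm_def
  proof (rule cSUP_least[OF ne])
    fix x assume x: "x \<in> carrier G"
    have "nrm ((T ^^ (m + n)) x) \<le> a m * nrm ((T ^^ n) x)"
      using a_bound[OF Tm[OF x]] by (simp add: funpow_add)
    also have "\<dots> \<le> a m * (a n * nrm x)"
      using a_bound[OF x] a_nonneg by (intro mult_left_mono)
    finally show "nrm ((T ^^ (m + n)) x) / nrm x \<le> a m * a n"
      using nrm_nonneg[OF x] a_nonneg by (cases "nrm x = 0") (simp_all add: divide_le_eq)
  qed
  define L where "L = lim (\<lambda>m. root m (a m))"
  have lim: "(\<lambda>m. root m (a m)) \<longlonglongrightarrow> L"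
    unfolding L_def using submultiplicative_root_convergent[OF a_nonneg a_sub]
    by (simp add: convergent_LIMSEQ_iff)
  have "L < s"
    using spec by (simp add: L_def a_def spectral_radius_def)
  \<comment> \<open>Strictly above the limit, so that almost all roots lie below \<rho>; strictly
    above 0, so that \<open>M\<close> may be formed by dividing by powers of \<rho>.\<close>
  then obtain \<rho> where rho: "max 0 L < \<rho>" "\<rho> < s"
    using dense[of "max 0 L" s] \<open>0 < s\<close> by auto
  have "eventually (\<lambda>m. root m (a m) < \<rho>) sequentially"
    using lim rho(1) by (intro order_tendstoD) auto
  then obtain N where N: "\<And>m. N \<le> m \<Longrightarrow> root m (a m) < \<rho>"
    by (auto simp: eventually_sequentially)
  define M where "M = 1 + (\<Sum>m\<le>N. a m / \<rho> ^ m)"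
  have rho0: "0 < \<rho>" using rho(1) by simp
  have sum_nonneg: "0 \<le> (\<Sum>m\<le>N. a m / \<rho> ^ m)"
    using a_nonneg rho0 by (intro sum_nonneg) auto
  have a_le: "a m \<le> M * \<rho> ^ m" for m
  proof (cases "m \<le> N")
    case True
    have "a m / \<rho> ^ m \<le> (\<Sum>m\<le>N. a m / \<rho> ^ m)"
      using a_nonneg rho0 True by (intro member_le_sum) auto
    then have "a m / \<rho> ^ m \<le> M" by (simp add: M_def)
    then show ?thesis using rho0 by (simp add: divide_le_eq)
  next
    case False
    have "a m = root m (a m) ^ m"
      using False a_nonneg by simp
    also have "\<dots> \<le> \<rho> ^ m"
      using N[of m] False real_root_ge_zero[OF a_nonneg] by (intro power_mono) auto
    also have "\<dots> \<le> M * \<rho> ^ m"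
      using rho0 sum_nonneg by (simp add: M_def)
    finally show ?thesis .
  qed
  show ?thesis
  proof (rule that)
    show "0 \<le> M" using sum_nonneg by (simp add: M_def)
    show "0 \<le> \<rho>" "\<rho> < s" using rho0 rho(2) by auto
    show "nrm ((T ^^ m) x) \<le> M * \<rho> ^ m * nrm x" if x: "x \<in> carrier G" for m x
      using a_bound[OF x, of m] mult_right_mono[OF a_le nrm_nonneg[OF x], of m] by linarith
  qed
qed

end


section \<open>The annulus algebra as a Banach algebra\<close>

lemma (in complete_valued_field) absv_uminus_one: "absv (\<ominus> \<one>) = 1"
proof -
  have "absv \<one> = 1"
    using absv_mult[of \<one> \<one>] absv_eq_0_iff[of \<one>] by simp
  then have "absv (\<ominus> \<one>) ^ 2 = 1"
    using absv_mult[of "\<ominus> \<one>" "\<ominus> \<one>"] by (simp add: l_minus power2_eq_square)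
  then show ?thesis
    using absv_nonneg[of "\<ominus> \<one>"] by (auto simp: power2_eq_1_iff)
qed

context nonarch_banach_space
begin

text \<open>The symmetry of the norm follows from writing the negative of \<open>x\<close> as (-1)
  times \<open>x\<close>, with |-1| = 1.\<close>

lemma complete_nonarch_group: "complete_nonarch_group V nrm"
proof
  fix x assume x: "x \<in> carrier V"
  have "nrm ((\<ominus> \<one>) \<odot>\<^bsub>V\<^esub> x) = nrm x"
    using x nrm_smult[of "\<ominus> \<one>" x] absv_uminus_one by simp
  then show "nrm (\<ominus>\<^bsub>V\<^esub> x) = nrm x"
    using x by (simp add: smult_l_minus)
qed (fact nrm_nonneg nrm_eq_0_iff nrm_add nrm_complete)+

end

section \<open>The supremum norm over all radii, and completeness\<close>

context twisted_annulus
begin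

lemma powi_le_max:
  assumes "t \<in> {s..r}"
  shows "t powi j \<le> max (s powi j) (r powi j)"
proof (cases "0 \<le> j")
  case True
  then have "t powi j \<le> r powi j"
    using assms radius_pos[OF assms] by (intro power_int_mono) auto
  then show ?thesis by simp
next
  case False
  have "s powi (- j) \<le> t powi (- j)"
    using False assms s_pos by (intro power_int_mono) auto
  then have "t powi j \<le> s powi j"
    using radius_pos[OF assms] s_pos by (simp add: power_int_minus)
  then show ?thesis by simp
qed

text \<open>Membership in the annulus bounds the terms at each radius separately. Powers are
  monotone in \<open>t\<close>, so the two end radii bound all others, and the suprema in
  \<open>annulus_norm\<close> are taken over bounded sets.\<close>

lemma annulus_norm_bdd:
  assumes u: "u \<in> annulus"
  shows "\<exists>B. \<forall>t\<in>{s..r}. \<forall>j. nrm (u j) * t powi j \<le> B"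
proof -
  have r: "r \<in> {s..r}" using s_le_r by simp
  obtain Bs where Bs: "\<And>j. nrm (u j) * s powi j \<le> Bs"
    using vanishing_bounded[OF annulus_vanishing[OF u s_in_radii]] by blast
  obtain Br where Br: "\<And>j. nrm (u j) * r powi j \<le> Br"
    using vanishing_bounded[OF annulus_vanishing[OF u r]] by blast
  have "nrm (u j) * t powi j \<le> max Bs Br" if t: "t \<in> {s..r}" for t j
  proof -
    have n: "0 \<le> nrm (u j)" using u annulus_closed nrm_nonneg by blast
    have "nrm (u j) * t powi j \<le> nrm (u j) * max (s powi j) (r powi j)"
      using n powi_le_max[OF t] by (intro mult_left_mono)
    also have "\<dots> = max (nrm (u j) * s powi j) (nrm (u j) * r powi j)"
      using n by (simp add: max_mult_distrib_left)
    also have "\<dots> \<le> max Bs Br"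
      using Bs[of j] Br[of j] by (intro max.mono)
    finally show ?thesis .
  qed
  then show ?thesis by blast
qed

abbreviation "anorm \<equiv> annulus_norm nrm s r"

lemma term_le_annulus_norm:
  assumes u: "u \<in> annulus" and t: "t \<in> {s..r}"
  shows "nrm (u j) * t powi j \<le> anorm u"
proof -
  obtain B where B: "\<And>t j. t \<in> {s..r} \<Longrightarrow> nrm (u j) * t powi j \<le> B"
    using annulus_norm_bdd[OF u] by blast
  have "nrm (u j) * t powi j \<le> (SUP j. nrm (u j) * t powi j)"
    using B[OF t] by (intro cSUP_upper bdd_aboveI[of _ B]) auto
  also have "\<dots> \<le> anorm u"
    unfolding annulus_norm_def using t B
    by (intro cSUP_upper bdd_aboveI[of _ B]) (auto intro!: cSUP_least)
  finally show ?thesis .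
qed

lemma annulus_norm_le:
  assumes "\<And>t j. t \<in> {s..r} \<Longrightarrow> nrm (u j) * t powi j \<le> B"
  shows "anorm u \<le> B"
  unfolding annulus_norm_def using s_in_radii assms
  by (intro cSUP_least) auto

lemma annulus_norm_nonneg: "u \<in> annulus \<Longrightarrow> 0 \<le> anorm u"
  using term_le_annulus_norm[OF _ s_in_radii, of u 0] annulus_term_nonneg[OF _ s_in_radii, of u 0]
  by simp

lemma annulus_norm_eq_0D:
  assumes u: "u \<in> annulus" and "anorm u = 0"
  shows "u j = \<zero>"
proof -
  have "nrm (u j) * s powi j \<le> 0"
    using term_le_annulus_norm[OF u s_in_radii, of j] assms(2) by simp
  then have "nrm (u j) = 0"
    using nrm_nonneg[OF annulus_closed[OF u]] s_pos
    by (metis annulus_term_nonneg[OF u s_in_radii] antisym mult_eq_0_iff power_int_not_zero order_less_irrefl)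
  then show ?thesis
    using nrm_eq_0_iff annulus_closed[OF u] by blast
qed

lemma annulus_norm_zero: "anorm (\<lambda>j. \<zero>) = 0"
  unfolding annulus_norm_def using s_le_r by (simp add: nrm_zero)

lemma annulus_norm_add:
  assumes u: "u \<in> annulus" and v: "v \<in> annulus"
  shows "anorm (\<lambda>j. u j \<oplus> v j) \<le> max (anorm u) (anorm v)"
proof (rule annulus_norm_le)
  fix t j assume t: "t \<in> {s..r}"
  have "nrm (u j \<oplus> v j) * t powi j \<le> max (nrm (u j)) (nrm (v j)) * t powi j"
    using radius_pos[OF t] annulus_closed u v by (intro mult_right_mono nrm_add) auto
  also have "\<dots> = max (nrm (u j) * t powi j) (nrm (v j) * t powi j)"
    using radius_pos[OF t] by (simp add: max_mult_distrib_right)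
  also have "\<dots> \<le> max (anorm u) (anorm v)"
    using u v t by (intro max.mono term_le_annulus_norm)
  finally show "nrm (u j \<oplus> v j) * t powi j \<le> max (anorm u) (anorm v)" .
qed

text \<open>The factor \<open>(\<rho> / t) ^ m\<close> is at most 1, so only \<open>C\<close> from
  the multiplication and \<open>M\<close> from the powers of \<delta> remain.\<close>

lemma annulus_norm_star:
  assumes u: "u \<in> annulus" and v: "v \<in> annulus"
  shows "anorm (u \<star> v) \<le> C * M * anorm u * anorm v"
proof (rule annulus_norm_le)
  fix t k assume t: "t \<in> {s..r}"
  obtain i m where im: "nrm ((u \<star> v) k) * t powi k \<le> C * M *
      ((nrm (u i) * t powi i) * ((\<rho> / t) ^ m * (nrm (v (k - i + int m)) * t powi (k - i + int m))))"
    using nrm_star_le[OF u v t] by blast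
  have "(\<rho> / t) ^ m \<le> 1"
    using rho_nonneg rho_less t by (intro power_le_one) auto
  then have "(\<rho> / t) ^ m * (nrm (v (k - i + int m)) * t powi (k - i + int m)) \<le> 1 * anorm v"
    using annulus_term_nonneg[OF v t] by (intro mult_mono term_le_annulus_norm v t) auto
  then have "(nrm (u i) * t powi i) * ((\<rho> / t) ^ m * (nrm (v (k - i + int m)) * t powi (k - i + int m)))
      \<le> anorm u * (1 * anorm v)"
    by (rule mult_mono[OF term_le_annulus_norm[OF u t]])
      (use rho_nonneg radius_pos[OF t] annulus_term_nonneg[OF v t] annulus_norm_nonneg[OF u] in simp_all)
  then have "C * M * ((nrm (u i) * t powi i) * ((\<rho> / t) ^ m * (nrm (v (k - i + int m)) * t powi (k - i + int m))))
      \<le> C * M * (anorm u * anorm v)"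
    using C_nonneg M_nonneg by (intro mult_left_mono) auto
  with im show "nrm ((u \<star> v) k) * t powi k \<le> C * M * anorm u * anorm v"
    by (simp add: mult.assoc)
qed

lemma zero_in_annulus: "(\<lambda>j. \<zero>) \<in> annulus"
  by (auto simp: annulus_iff vanishing_def nrm_zero)

lemma annulus_uminus: "u \<in> annulus \<Longrightarrow> (\<lambda>j. \<ominus> u j) \<in> annulus"
  by (simp add: annulus_iff nrm_uminus)

lemma annulus_norm_uminus: "u \<in> annulus \<Longrightarrow> anorm (\<lambda>j. \<ominus> u j) = anorm u"
  by (simp add: annulus_norm_def nrm_uminus annulus_closed)

text \<open>Coefficientwise limits; the uniform estimates at each radius pass to the limit.\<close>

lemma annulus_Cauchy_limit:
  fixes \<sigma> :: "nat \<Rightarrow> int \<Rightarrow> 'a"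
  assumes sigma: "\<And>n. \<sigma> n \<in> annulus"
    and Cauchy: "\<And>e. 0 < e \<Longrightarrow> \<exists>N. \<forall>m\<ge>N. \<forall>n\<ge>N. anorm (\<lambda>j. \<sigma> m j \<ominus> \<sigma> n j) < e"
  obtains x where "x \<in> annulus" "\<And>e. 0 < e \<Longrightarrow> \<exists>N. \<forall>n\<ge>N. anorm (\<lambda>j. \<sigma> n j \<ominus> x j) < e"
proof -
  have sc: "\<sigma> n j \<in> carrier A" for n j
    using sigma annulus_closed by blast
  have diff: "(\<lambda>j. \<sigma> m j \<ominus> \<sigma> n j) \<in> annulus" for m n
    using annulus_add[OF sigma annulus_uminus[OF sigma]] by (simp add: minus_eq)
  have lim: "\<exists>x\<in>carrier A. \<forall>e>0. \<exists>N. \<forall>n\<ge>N. nrm (\<sigma> n j \<ominus> x) < e" for j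
  proof (rule nrm_complete[unfolded norm_complete_iff, rule_format])
    show "range (\<lambda>n. \<sigma> n j) \<subseteq> carrier A" using sc by auto
    fix e :: real assume e: "0 < e"
    \<comment> \<open>The norm sees coefficient \<open>j\<close> with weight
      \<open>s powi j\<close>, so this \<open>N\<close> depends on \<open>j\<close>.\<close>
    obtain N where N: "\<And>m n. N \<le> m \<Longrightarrow> N \<le> n \<Longrightarrow> anorm (\<lambda>j. \<sigma> m j \<ominus> \<sigma> n j) < e * s powi j"
      using Cauchy[of "e * s powi j"] e s_pos by auto
    have "nrm (\<sigma> m j \<ominus> \<sigma> n j) < e" if "N \<le> m" "N \<le> n" for m n
    proof -
      have "nrm (\<sigma> m j \<ominus> \<sigma> n j) * s powi j < e * s powi j"
        using term_le_annulus_norm[OF diff[of m n] s_in_radii, of j] N[OF that] by linarith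
      then show ?thesis using s_pos by simp
    qed
    then show "\<exists>N. \<forall>m\<ge>N. \<forall>n\<ge>N. nrm (\<sigma> m j \<ominus> \<sigma> n j) < e" by blast
  qed
  then obtain x where xc: "\<And>j. x j \<in> carrier A"
      and x: "\<And>j e. 0 < e \<Longrightarrow> \<exists>N. \<forall>n\<ge>N. nrm (\<sigma> n j \<ominus> x j) < e"
    by metis
  \<comment> \<open>Uniformity in \<open>t\<close> and \<open>j\<close> is regained here: the
    auxiliary index \<open>?m\<close> may depend on both, but the ultrametric inequality eliminates
    it and \<open>N\<close> does not depend on them.\<close>
  have approx: "\<exists>N. \<forall>n\<ge>N. \<forall>t\<in>{s..r}. \<forall>j. nrm (\<sigma> n j \<ominus> x j) * t powi j \<le> e" if e: "0 < e" for e
  proof -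
    obtain N where N: "\<And>m n. N \<le> m \<Longrightarrow> N \<le> n \<Longrightarrow> anorm (\<lambda>j. \<sigma> m j \<ominus> \<sigma> n j) < e"
      using Cauchy[OF e] by blast
    have "nrm (\<sigma> n j \<ominus> x j) * t powi j \<le> e" if n: "N \<le> n" and t: "t \<in> {s..r}" for n t j
    proof -
      have t0: "0 < t powi j" using radius_pos[OF t] by simp
      obtain N' where N': "\<And>m. N' \<le> m \<Longrightarrow> nrm (\<sigma> m j \<ominus> x j) < e / t powi j"
        using x[of "e / t powi j" j] e t0 by auto
      let ?m = "max N N'"
      have "nrm (\<sigma> n j \<ominus> \<sigma> ?m j) * t powi j \<le> e"
        using term_le_annulus_norm[OF diff[of n ?m] t, of j] N[OF n, of ?m] by simp
      moreover have "nrm (\<sigma> ?m j \<ominus> x j) * t powi j \<le> e"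
        using N'[of ?m] t0 by (simp add: less_divide_eq)
      moreover have "nrm (\<sigma> n j \<ominus> x j) * t powi j \<le>
          max (nrm (\<sigma> n j \<ominus> \<sigma> ?m j)) (nrm (\<sigma> ?m j \<ominus> x j)) * t powi j"
        using t0 by (intro mult_right_mono nrm_triangle sc xc) simp
      ultimately show ?thesis
        by (auto simp: max_def split: if_splits)
    qed
    then show ?thesis by blast
  qed
  have diff_x: "vanishing (\<lambda>j. nrm (x j) * t powi j)" if t: "t \<in> {s..r}" for t
    unfolding vanishing_def
  proof (intro allI impI)
    fix e :: real assume e: "0 < e"
    then obtain n where n: "\<And>j. nrm (\<sigma> n j \<ominus> x j) * t powi j \<le> e / 2"
      using approx[of "e / 2"] t by (metis half_gt_zero order_refl)
    have t0: "0 < t powi j" for j using radius_pos[OF t] by simp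
    \<comment> \<open>The error is at most \<open>e / 2\<close>, so the ultrametric inequality
      leaves the threshold \<open>e\<close> intact in passing from \<open>x\<close> to
      \<open>\<sigma> n\<close>.\<close>
    have "{j. e \<le> nrm (x j) * t powi j} \<subseteq> {j. e \<le> nrm (\<sigma> n j) * t powi j}"
    proof
      fix j assume "j \<in> {j. e \<le> nrm (x j) * t powi j}"
      then have "e \<le> nrm (x j) * t powi j" ..
      also have "nrm (x j) \<le> max (nrm (x j \<ominus> \<sigma> n j)) (nrm (\<sigma> n j))"
        using nrm_triangle[OF xc sc zero_closed, of j n j] xc sc by (simp add: minus_eq)
      then have "nrm (x j) * t powi j \<le> max (nrm (x j \<ominus> \<sigma> n j)) (nrm (\<sigma> n j)) * t powi j"
        using t0[of j] by (intro mult_right_mono) auto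
      also have "nrm (x j \<ominus> \<sigma> n j) = nrm (\<sigma> n j \<ominus> x j)"
        by (rule nrm_minus_commute[OF xc sc])
      finally show "j \<in> {j. e \<le> nrm (\<sigma> n j) * t powi j}"
        using n[of j] e by (auto simp: max_def split: if_splits)
    qed
    then show "finite {j. e \<le> nrm (x j) * t powi j}"
      using vanishingD[OF annulus_vanishing[OF sigma t] e] finite_subset by blast
  qed
  have xa: "x \<in> annulus"
    unfolding annulus_iff using xc diff_x by blast
  show ?thesis
  proof (rule that[OF xa])
    fix e :: real assume e: "0 < e"
    then obtain N where "\<forall>n\<ge>N. \<forall>t\<in>{s..r}. \<forall>j. nrm (\<sigma> n j \<ominus> x j) * t powi j \<le> e / 2"
      using approx[of "e / 2"] by auto
    then have "anorm (\<lambda>j. \<sigma> n j \<ominus> x j) \<le> e / 2" if "N \<le> n" for n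
      by (intro annulus_norm_le) (use that in blast)
    then show "\<exists>N. \<forall>n\<ge>N. anorm (\<lambda>j. \<sigma> n j \<ominus> x j) < e"
      using e by (intro exI[of _ N]) force
  qed
qed

end

locale twisted_annulus_algebra =
  nonarch_banach_algebra K absv A nrm + twisted_annulus A nrm \<delta> s r C M \<rho>
  for K (structure) and absv :: "'k \<Rightarrow> real" and A (structure) and nrm :: "'a \<Rightarrow> real"
    and \<delta> s r C M \<rho> +
  assumes delta_smult: "\<lbrakk>c \<in> carrier K; x \<in> carrier A\<rbrakk> \<Longrightarrow> \<delta> (c \<odot>\<^bsub>A\<^esub> x) = c \<odot>\<^bsub>A\<^esub> \<delta> x"
begin

abbreviation "alg \<equiv> annulus_algebra A nrm \<delta> s r"

lemma alg_simps:
  "carrier alg = annulus"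
  "u \<otimes>\<^bsub>alg\<^esub> v = u \<star> v"
  "\<one>\<^bsub>alg\<^esub> = \<one>\<^sub>a"
  "\<zero>\<^bsub>alg\<^esub> = (\<lambda>j. \<zero>\<^bsub>A\<^esub>)"
  "u \<oplus>\<^bsub>alg\<^esub> v = (\<lambda>j. u j \<oplus>\<^bsub>A\<^esub> v j)"
  "c \<odot>\<^bsub>alg\<^esub> u = (\<lambda>j. c \<odot>\<^bsub>A\<^esub> u j)"
  by (simp_all add: annulus_algebra_def)

lemma annulus_smult:
  assumes c: "c \<in> carrier K" and u: "u \<in> annulus"
  shows "(\<lambda>j. c \<odot>\<^bsub>A\<^esub> u j) \<in> annulus"
  unfolding annulus_iff
proof (intro conjI allI ballI)
  show "c \<odot>\<^bsub>A\<^esub> u j \<in> carrier A" for j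
    using c u annulus_closed by simp
  fix t assume t: "t \<in> {s..r}"
  show "vanishing (\<lambda>j. nrm (c \<odot>\<^bsub>A\<^esub> u j) * t powi j)"
    by (rule vanishing_le[OF annulus_vanishing[OF u t], of _ "absv c"])
      (simp_all add: nrm_smult c u annulus_closed absv_nonneg)
qed

text \<open>The lower estimate is the upper one for \<open>u\<close> divided by
  \<open>absv c\<close>; the case of \<open>absv c = 0\<close> is just nonnegativity.\<close>

lemma annulus_norm_smult:
  assumes c: "c \<in> carrier K" and u: "u \<in> annulus"
  shows "anorm (\<lambda>j. c \<odot>\<^bsub>A\<^esub> u j) = absv c * anorm u"
proof (rule antisym)
  have eq: "nrm (c \<odot>\<^bsub>A\<^esub> u j) * t powi j = absv c * (nrm (u j) * t powi j)" for t j
    by (simp add: nrm_smult c u annulus_closed)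
  show "anorm (\<lambda>j. c \<odot>\<^bsub>A\<^esub> u j) \<le> absv c * anorm u"
    using absv_nonneg[OF c] term_le_annulus_norm[OF u]
    by (intro annulus_norm_le) (auto simp: eq intro!: mult_left_mono)
  show "absv c * anorm u \<le> anorm (\<lambda>j. c \<odot>\<^bsub>A\<^esub> u j)"
  proof (cases "absv c = 0")
    case True
    then show ?thesis
      using annulus_norm_nonneg[OF annulus_smult[OF c u]] by simp
  next
    case False
    then have c0: "0 < absv c" using absv_nonneg[OF c] by simp
    have "anorm u \<le> anorm (\<lambda>j. c \<odot>\<^bsub>A\<^esub> u j) / absv c"
    proof (rule annulus_norm_le)
      fix t j assume t: "t \<in> {s..r}"
      show "nrm (u j) * t powi j \<le> anorm (\<lambda>j. c \<odot>\<^bsub>A\<^esub> u j) / absv c"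
        using term_le_annulus_norm[OF annulus_smult[OF c u] t, of j] c0
        unfolding eq by (simp add: le_divide_eq mult_ac)
    qed
    then show ?thesis
      using c0 by (simp add: le_divide_eq mult.commute)
  qed
qed

lemma delta_pow_smult:
  "\<lbrakk>c \<in> carrier K; x \<in> carrier A\<rbrakk> \<Longrightarrow> (\<delta> ^^ m) (c \<odot>\<^bsub>A\<^esub> x) = c \<odot>\<^bsub>A\<^esub> (\<delta> ^^ m) x"
  by (induction m) (simp_all add: delta_smult delta_pow_closed)

lemma has_nsum_smult:
  assumes "has_nsum f x" "\<And>i. f i \<in> carrier A" and c: "c \<in> carrier K"
  shows "has_nsum (\<lambda>i. c \<odot>\<^bsub>A\<^esub> f i) (c \<odot>\<^bsub>A\<^esub> x)"
  by (rule has_norm_sum_map[OF _ _ assms(1,2), of "\<lambda>x. c \<odot>\<^bsub>A\<^esub> x" "absv c"])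
    (simp_all add: c smult_r_distr nrm_smult)

lemma shift_smult:
  assumes c: "c \<in> carrier K" and v: "v \<in> annulus"
  shows "shift i (\<lambda>j. c \<odot>\<^bsub>A\<^esub> v j) k = c \<odot>\<^bsub>A\<^esub> shift i v k"
proof -
  have "has_nsum (\<lambda>m. c \<odot>\<^bsub>A\<^esub> star_inner A \<delta> v k i m) (c \<odot>\<^bsub>A\<^esub> shift i v k)"
    by (rule has_nsum_smult[OF has_nsum_shift[OF v] inner_closed[OF v] c])
  moreover have "c \<odot>\<^bsub>A\<^esub> star_inner A \<delta> v k i m = star_inner A \<delta> (\<lambda>j. c \<odot>\<^bsub>A\<^esub> v j) k i m" for m
    unfolding star_inner_def delta_pow_smult[OF c annulus_closed[OF v]]
    by (rule additive_map_int_mult) (simp_all add: c smult_r_distr delta_pow_closed annulus_closed v)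
  ultimately have "has_nsum (star_inner A \<delta> (\<lambda>j. c \<odot>\<^bsub>A\<^esub> v j) k i) (c \<odot>\<^bsub>A\<^esub> shift i v k)"
    by simp
  then show ?thesis
    unfolding shift_def[of i "\<lambda>j. c \<odot>\<^bsub>A\<^esub> v j"] by (rule norm_sum_eqI)
qed

lemma smult_star:
  assumes c: "c \<in> carrier K" and u: "u \<in> annulus" and v: "v \<in> annulus"
  shows "(\<lambda>j. c \<odot>\<^bsub>A\<^esub> u j) \<star> v = (\<lambda>k. c \<odot>\<^bsub>A\<^esub> (u \<star> v) k)"
    and "u \<star> (\<lambda>j. c \<odot>\<^bsub>A\<^esub> v j) = (\<lambda>k. c \<odot>\<^bsub>A\<^esub> (u \<star> v) k)"
proof -
  have sum: "nsum (\<lambda>i. c \<odot>\<^bsub>A\<^esub> (u i \<otimes>\<^bsub>A\<^esub> shift i v k)) = c \<odot>\<^bsub>A\<^esub> (u \<star> v) k" for k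
    by (intro norm_sum_eqI has_nsum_smult has_nsum_star outer_closed u v c)
  show "(\<lambda>j. c \<odot>\<^bsub>A\<^esub> u j) \<star> v = (\<lambda>k. c \<odot>\<^bsub>A\<^esub> (u \<star> v) k)"
    by (rule ext) (simp add: star_mult_shift[of "\<lambda>j. c \<odot>\<^bsub>A\<^esub> u j"] sum
        smult_mult_left c u v annulus_closed shift_closed)
  show "u \<star> (\<lambda>j. c \<odot>\<^bsub>A\<^esub> v j) = (\<lambda>k. c \<odot>\<^bsub>A\<^esub> (u \<star> v) k)"
    by (rule ext) (simp add: star_mult_shift[of u "\<lambda>j. c \<odot>\<^bsub>A\<^esub> v j"] sum shift_smult
        smult_mult_right c u v annulus_closed shift_closed)
qed

section \<open>Verification of the Banach algebra axioms\<close>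

lemma abelian_group_alg: "abelian_group alg"
proof (rule abelian_groupI)
  fix u assume u: "u \<in> carrier alg"
  then show "\<exists>v\<in>carrier alg. v \<oplus>\<^bsub>alg\<^esub> u = \<zero>\<^bsub>alg\<^esub>"
    by (intro bexI[of _ "\<lambda>j. \<ominus>\<^bsub>A\<^esub> u j"]) (simp_all add: alg_simps M.l_neg annulus_closed annulus_uminus)
qed (simp_all add: alg_simps annulus_add zero_in_annulus annulus_closed M.a_ac)

lemma ring_alg: "ring alg"
proof (intro ringI abelian_group_alg)
  show "monoid alg"
    by (rule monoidI)
      (simp_all add: alg_simps star_in_annulus one_in_annulus star_assoc one_star star_one)
qed (simp_all add: alg_simps star_l_distr star_r_distr)

lemma uminus_alg: "u \<in> annulus \<Longrightarrow> \<ominus>\<^bsub>alg\<^esub> u = (\<lambda>j. \<ominus>\<^bsub>A\<^esub> u j)"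
  by (rule abelian_group.minus_equality[OF abelian_group_alg])
    (simp_all add: alg_simps M.l_neg annulus_closed annulus_uminus)

lemma minus_alg: "v \<in> annulus \<Longrightarrow> u \<ominus>\<^bsub>alg\<^esub> v = (\<lambda>j. u j \<ominus>\<^bsub>A\<^esub> v j)"
  by (simp add: a_minus_def uminus_alg alg_simps)

lemma nonarch_normed_group_alg: "nonarch_normed_group alg anorm"
proof (intro nonarch_normed_group.intro nonarch_normed_group_axioms.intro abelian_group_alg)
  fix u v assume u: "u \<in> carrier alg"
  then show "0 \<le> anorm u"
    by (simp add: alg_simps annulus_norm_nonneg)
  show "anorm u = 0 \<longleftrightarrow> u = \<zero>\<^bsub>alg\<^esub>"
    using u annulus_norm_eq_0D annulus_norm_zero by (auto simp: alg_simps)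
  show "anorm (\<ominus>\<^bsub>alg\<^esub> u) = anorm u"
    using u by (simp add: alg_simps uminus_alg annulus_norm_uminus)
  assume "v \<in> carrier alg"
  with u show "anorm (u \<oplus>\<^bsub>alg\<^esub> v) \<le> max (anorm u) (anorm v)"
    by (simp add: alg_simps annulus_norm_add)
qed

lemma norm_complete_alg: "norm_complete alg anorm"
  unfolding nonarch_normed_group.norm_complete_iff[OF nonarch_normed_group_alg]
proof (intro allI impI)
  fix \<sigma> :: "nat \<Rightarrow> int \<Rightarrow> 'a"
  assume "range \<sigma> \<subseteq> carrier alg"
  then have sigma: "\<sigma> n \<in> annulus" for n
    by (auto simp: alg_simps)
  assume "\<forall>e>0. \<exists>N. \<forall>m\<ge>N. \<forall>n\<ge>N. anorm (\<sigma> m \<ominus>\<^bsub>alg\<^esub> \<sigma> n) < e"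
  then have "\<exists>N. \<forall>m\<ge>N. \<forall>n\<ge>N. anorm (\<lambda>j. \<sigma> m j \<ominus>\<^bsub>A\<^esub> \<sigma> n j) < e" if "0 < e" for e
    using that by (simp add: minus_alg sigma)
  then obtain x where x: "x \<in> annulus"
      "\<And>e. 0 < e \<Longrightarrow> \<exists>N. \<forall>n\<ge>N. anorm (\<lambda>j. \<sigma> n j \<ominus>\<^bsub>A\<^esub> x j) < e"
    using annulus_Cauchy_limit[of \<sigma>, OF sigma] by blast
  then show "\<exists>x\<in>carrier alg. \<forall>e>0. \<exists>N. \<forall>n\<ge>N. anorm (\<sigma> n \<ominus>\<^bsub>alg\<^esub> x) < e"
    by (intro bexI[of _ x]) (simp_all add: minus_alg alg_simps)
qed

lemma module_alg: "Module.module K alg"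
proof (rule moduleI)
  show "cring K" by (rule module.axioms(1)[OF module_axioms])
  show "abelian_group alg" by (rule abelian_group_alg)
qed (simp_all add: alg_simps annulus_smult annulus_closed smult_l_distr smult_r_distr smult_assoc1)

lemma nonarch_banach_algebra_alg: "nonarch_banach_algebra K absv alg anorm"
proof -
  interpret N: nonarch_normed_group alg anorm
    by (rule nonarch_normed_group_alg)
  have "nonarch_banach_space K absv alg anorm"
  proof (intro nonarch_banach_space.intro nonarch_banach_space_axioms.intro module_alg norm_complete_alg)
    show "complete_valued_field K absv" by unfold_locales
  qed (simp_all add: N.nrm_nonneg N.nrm_eq_0_iff N.nrm_add, simp add: alg_simps annulus_norm_smult)
  moreover have "nonarch_banach_algebra_axioms K alg anorm"
  proof (intro nonarch_banach_algebra_axioms.intro)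
    show "\<exists>D. \<forall>u\<in>carrier alg. \<forall>v\<in>carrier alg. anorm (u \<otimes>\<^bsub>alg\<^esub> v) \<le> D * anorm u * anorm v"
      using annulus_norm_star by (intro exI[of _ "C * M"]) (simp add: alg_simps)
  qed (simp_all add: alg_simps smult_star)
  ultimately show ?thesis
    by (intro nonarch_banach_algebra.intro ring_alg)
qed

end

theorem theorem2p2p6:
  fixes p :: nat
    and K :: "('k, 'mk) ring_scheme" and absv :: "'k \<Rightarrow> real"
    and A :: "('k, 'a, 'ma) module_scheme" and nrm :: "'a \<Rightarrow> real"
    and \<delta> :: "'a \<Rightarrow> 'a" and s r :: real
  assumes "prime p"
    and "complete_valued_field K absv"
    and "absv ([p] \<cdot>\<^bsub>K\<^esub> \<one>\<^bsub>K\<^esub>) = 1 / real p"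
    and "nonarch_banach_algebra K absv A nrm"
    and "0 < s" and "s \<le> r"
    and "linear_operator K A \<delta>" and "bounded_operator A nrm \<delta>" and "derivation A \<delta>"
    and "spectral_radius A nrm \<delta> < s"
  shows "(\<forall>u\<in>carrier (annulus_algebra A nrm \<delta> s r). \<forall>v\<in>carrier (annulus_algebra A nrm \<delta> s r).
            star_convergent A nrm \<delta> u v)
         \<and> nonarch_banach_algebra K absv (annulus_algebra A nrm \<delta> s r) (annulus_norm nrm s r)"
proof -
  interpret A: nonarch_banach_algebra K absv A nrm by fact
  interpret G: complete_nonarch_group A nrm by (rule A.complete_nonarch_group)
  have closed: "\<delta> x \<in> carrier A" if "x \<in> carrier A" for x
    using \<open>linear_operator K A \<delta>\<close> that by (auto simp: linear_operator_def)
  obtain M \<rho> where M: "0 \<le> M" "0 \<le> \<rho>" "\<rho> < s"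
      "\<And>m x. x \<in> carrier A \<Longrightarrow> nrm ((\<delta> ^^ m) x) \<le> M * \<rho> ^ m * nrm x"
    using G.spectral_radius_power_bound[OF closed \<open>bounded_operator A nrm \<delta>\<close>
        \<open>spectral_radius A nrm \<delta> < s\<close> \<open>0 < s\<close>] by blast
  obtain C where C: "\<And>x y. x \<in> carrier A \<Longrightarrow> y \<in> carrier A \<Longrightarrow> nrm (x \<otimes>\<^bsub>A\<^esub> y) \<le> C * nrm x * nrm y"
    using A.mult_bounded by blast
  \<comment> \<open>The constant \<open>C\<close> in \<open>mult_bounded\<close> has no prescribed
    sign, hence the absolute value.\<close>
  interpret T: twisted_annulus_algebra K absv A nrm \<delta> s r "\<bar>C\<bar>" M \<rho>
  proof unfold_locales
    fix x y assume xy: "x \<in> carrier A" "y \<in> carrier A"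
    have "C * (nrm x * nrm y) \<le> \<bar>C\<bar> * (nrm x * nrm y)"
      using xy by (intro mult_right_mono) (auto simp: G.nrm_nonneg)
    then show "nrm (x \<otimes>\<^bsub>A\<^esub> y) \<le> \<bar>C\<bar> * nrm x * nrm y"
      using C[OF xy] by (simp add: mult.assoc)
  qed (use M closed \<open>s \<le> r\<close> \<open>linear_operator K A \<delta>\<close> \<open>derivation A \<delta>\<close> in
      \<open>auto simp: linear_operator_def derivation_def\<close>)
  show ?thesis
    using T.star_convergent T.nonarch_banach_algebra_alg by (simp add: T.alg_simps)
qed

end
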